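(* Let $\Phi_1=\{xx,\ xx^R\}$, let $$\Phi_2=\{\,xx,\ x x^R,\ xyx\cdot yxy,\ xy\cdot yx\cdot x^R\cdot y^R,\ xy\cdot y x^R\cdot y^R,\ xy\cdot y^R x^R,\ xyx\cdot y^R\,\},$$ and let $\Phi_3$ be the union of $\Phi_2$ with the set of the following formulas with reversal: $xy\cdot xz\cdot y^R z$, $\ x y^R\cdot y z^R\cdot z x^R$; $xyzyx\cdot zyxyz$, $\ xyzyx\cdot zyx y^R z$, $\ xyzyx\cdot z y^R xyz$, $\ xyzyx\cdot z y^R x y^R z$, $\ xyz y^R x\cdot zyx y^R z$, $\ xyz y^R x\cdot z y^R xyz$; $xy\cdot xz\cdot yz\cdot y^R$, $\ xy\cdot xz\cdot y^R z^R$, $\ yx\cdot zx\cdot z^R y^R$, $\ xy\cdot xz\cdot y z^R\cdot y^R$, $\ yx\cdot zx\cdot z^R y\cdot y^R$, $\ xy\cdot x^R z^R\cdot yz\cdot y^R$, $\ xy\cdot x^R z^R\cdot y^R z$; $xyzx\cdot yzxy\cdot zxyz$, $\ xyzx\cdot yzxy\cdot zyz$, $\ xzyx\cdot yxzy\cdot zyz$, $\ xyzx\cdot yzxy\cdot z^R$, $\ xyzx\cdot y z^R xy$; $xy\cdot xz\cdot yx\cdot zx\cdot zy$, $\ xy\cdot yz\cdot zx\cdot x^R\cdot y^R\cdot z^R$, $\ xy\cdot yz\cdot z x^R\cdot y^R\cdot z^R$, $\ xy\cdot yz\cdot z^R x^R\cdot y^R$, $\ xyzx\cdot y^R\cdot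 z^R$. Then for each $n\in\{1,2,3\}$ there is a unique element of $\Phi_n$ of highest avoidability index, and that index is $n+2$. Namely: (1) $xx$ has avoidability index $3$ and every other element of $\Phi_1$ has avoidability index less than $3$; (2) $xyx\cdot y^R$ has avoidability index $4$ and every other element of $\Phi_2$ has avoidability index less than $4$; (3) $xyzx\cdot y^R\cdot z^R$ has avoidability index $5$ and every other element of $\Phi_3$ has avoidability index less than $5$.
   Context: For a set $\Sigma$ of variables let $\Sigma^R=\{x^R: x\in\Sigma\}$ be a disjoint copy. A pattern with reversal over $\Sigma$ is a finite word over $\Sigma\cup\Sigma^R$; a formula with reversal over $\Sigma$ is a finite set of such patterns, called its fragments, and the set $\{p_1,\dots,p_n\}$ is written $p_1\cdot p_2\cdot\ldots\cdot p_n$. For an alphabet $A$, a morphism $f:(\Sigma\cup\Sigma^R)^*\to A^*$ respects reversal if $f(x^R)$ is the reversal (mirror image) of the word $f(x)$ for every $x\in\Sigma$. A formula with reversal $\phi$ occurs in a word $w$ if there is a non-erasing morphism $f$ respecting reversal such that $f(p)$ is a factor (contiguous subword) of $w$ for every fragment $p$ of $\phi$; otherwise $w$ avoids $\phi$. $\phi$ is $k$-avoidable if infinitely many words over a $k$-letter alphabet avoid $\phi$. The avoidability index of $\phi$ is the smallest $k$ such that $\phi$ is $k$-avoidable, and is $\infty$ if there is no such $k$. (The sets $\Phi_1,\Phi_2,\Phi_3$ are avoidance bases for formulas with reversal on $1$, $2$ and $3$ variables respectively.) *)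

theory Defs
  imports "HOL-Library.FSet" "HOL-Library.Extended_Nat" "HOL-Library.Sublist"
begin

section \<open>Formulas with reversal\<close>

text \<open>The alphabet \<open>\<Sigma>\<close> of variables is the type \<open>'v\<close>; \<open>Var x\<close> is the letter \<open>x\<close> of \<open>\<Sigma>\<close>
  and \<open>Rev x\<close> is the letter \<open>x\<^sup>R\<close> of the disjoint copy.\<close>

datatype 'v letter = Var 'v | Rev 'v

type_synonym 'v pattern = "'v letter list"

type_synonym 'v formula = "'v pattern fset"

definition morphism :: "('b list \<Rightarrow> 'a list) \<Rightarrow> bool" where
  "morphism f \<longleftrightarrow> (\<forall>u v. f (u @ v) = f u @ f v)"

definition nonerasing :: "('b list \<Rightarrow> 'a list) \<Rightarrow> bool" where
  "nonerasing f \<longleftrightarrow> (\<forall>u. u \<noteq> [] \<longrightarrow> f u \<noteq> [])"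

definition respects_reversal :: "('v letter list \<Rightarrow> 'a list) \<Rightarrow> bool" where
  "respects_reversal f \<longleftrightarrow> (\<forall>x. f [Rev x] = rev (f [Var x]))"

text \<open>Note that \<^const>\<open>sublist\<close> is the relation of being a contiguous factor.\<close>

definition occurs :: "'v formula \<Rightarrow> 'a list \<Rightarrow> bool" where
  "occurs \<phi> w \<longleftrightarrow>
     (\<exists>f :: 'v letter list \<Rightarrow> 'a list.
        morphism f \<and> nonerasing f \<and> respects_reversal f \<and>
        (\<forall>p. p |\<in>| \<phi> \<longrightarrow> sublist (f p) w))"

definition avoids :: "'a list \<Rightarrow> 'v formula \<Rightarrow> bool" where
  "avoids w \<phi> \<longleftrightarrow> \<not> occurs \<phi> w"

text \<open>The letters of a \<open>k\<close>-letter alphabet may be named arbitrarily; we take \<open>{0, \<dots>, k - 1}\<close>.\<close>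

definition avoidable :: "nat \<Rightarrow> 'v formula \<Rightarrow> bool" where
  "avoidable k \<phi> \<longleftrightarrow> infinite {w \<in> lists {..<k}. avoids w \<phi>}"

definition avoidability_index :: "'v formula \<Rightarrow> enat" where
  "avoidability_index \<phi> =
     (if \<exists>k. avoidable k \<phi> then enat (LEAST k. avoidable k \<phi>) else \<infinity>)"


section \<open>The avoidance bases\<close>

text \<open>The formulas in one and two variables are also read over the three-letter set of variables;
  a variable not used in a formula does not influence where the formula occurs.\<close>

datatype var = vx | vy | vz

abbreviation X :: "var letter" where "X \<equiv> Var vx"
abbreviation Y :: "var letter" where "Y \<equiv> Var vy"
abbreviation Z :: "var letter" where "Z \<equiv> Var vz"
abbreviation XR :: "var letter" where "XR \<equiv> Rev vx"
abbreviation YR :: "var letter" where "YR \<equiv> Rev vy"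
abbreviation ZR :: "var letter" where "ZR \<equiv> Rev vz"

definition Phi1 :: "var formula set" where
  "Phi1 = { {|[X,X]|}, {|[X,XR]|} }"

definition Phi2 :: "var formula set" where
  "Phi2 = {
     {|[X,X]|},
     {|[X,XR]|},
     {|[X,Y,X], [Y,X,Y]|},
     {|[X,Y], [Y,X], [XR], [YR]|},
     {|[X,Y], [Y,XR], [YR]|},
     {|[X,Y], [YR,XR]|},
     {|[X,Y,X], [YR]|} }"

definition Phi3 :: "var formula set" where
  "Phi3 = Phi2 \<union> {
     {|[X,Y], [X,Z], [YR,Z]|},
     {|[X,YR], [Y,ZR], [Z,XR]|},

     {|[X,Y,Z,Y,X], [Z,Y,X,Y,Z]|},
     {|[X,Y,Z,Y,X], [Z,Y,X,YR,Z]|},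
     {|[X,Y,Z,Y,X], [Z,YR,X,Y,Z]|},
     {|[X,Y,Z,Y,X], [Z,YR,X,YR,Z]|},
     {|[X,Y,Z,YR,X], [Z,Y,X,YR,Z]|},
     {|[X,Y,Z,YR,X], [Z,YR,X,Y,Z]|},

     {|[X,Y], [X,Z], [Y,Z], [YR]|},
     {|[X,Y], [X,Z], [YR,ZR]|},
     {|[Y,X], [Z,X], [ZR,YR]|},
     {|[X,Y], [X,Z], [Y,ZR], [YR]|},
     {|[Y,X], [Z,X], [ZR,Y], [YR]|},
     {|[X,Y], [XR,ZR], [Y,Z], [YR]|},
     {|[X,Y], [XR,ZR], [YR,Z]|},

     {|[X,Y,Z,X], [Y,Z,X,Y], [Z,X,Y,Z]|},
     {|[X,Y,Z,X], [Y,Z,X,Y], [Z,Y,Z]|},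
     {|[X,Z,Y,X], [Y,X,Z,Y], [Z,Y,Z]|},
     {|[X,Y,Z,X], [Y,Z,X,Y], [ZR]|},
     {|[X,Y,Z,X], [Y,ZR,X,Y]|},

     {|[X,Y], [X,Z], [Y,X], [Z,X], [Z,Y]|},
     {|[X,Y], [Y,Z], [Z,X], [XR], [YR], [ZR]|},
     {|[X,Y], [Y,Z], [Z,XR], [YR], [ZR]|},
     {|[X,Y], [Y,Z], [ZR,XR], [YR]|},
     {|[X,Y,Z,X], [YR], [ZR]|} }"

end

theory Submission
  imports Defs "HOL-Number_Theory.Cong"
begin

text \<open>If enough variables occur together with their reversals, then the periodic word
  \<open>012\<dots>012\<dots>\<close> avoids the formula, because only single letters are reversible in it. The other
  avoiding words are built from paperfolding words: writing \<open>t + 1 = 2 ^ k * (2 * j + 1)\<close>, block \<open>t\<close>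
  depends on the parity of \<open>t\<close> and on \<open>j\<close> modulo \<open>2 ^ e\<close> only. Shifting by an odd multiple of
  \<open>2 ^ (k + e - 1)\<close> blocks changes every block with this \<open>k\<close>, and every \<open>2 ^ (k + 1)\<close> consecutive
  blocks contain such a block; so by induction on \<open>k\<close> two occurrences of a factor about as long as
  \<open>2 ^ k\<close> blocks are at a distance divisible by \<open>2 ^ (k + e)\<close> blocks. An occurrence of a formula thus
  gives congruences between sums of the lengths of the images that are too large to hold. Images too
  short for this argument are excluded by a finite search among short factors.

  For the lower bounds, every word that extends indefinitely to both sides within words avoiding the
  formula is refuted by a search tree. The trees stay small because words refuted before, their
  reversals and their images under permutations of the letters can be pruned.\<close>

section \<open>Occurrences in infinite words\<close>

text \<open>The parameters of the paperfolding words come from the slack that a formula leaves. For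
  occurrences of a factor of length \<open>l\<close> the modulus is at least
  \<open>2 ^ (e - 1) * (l + w)\<close>, where \<open>w\<close> is the number of consecutive letters
  of a block that the critical shift changes. With \<open>e = 1\<close> the surplus \<open>w\<close>
  must exceed what stands between two copies of a repeated image: at most 2 letters for
  \<open>xyx . y^R\<close> in \<open>wordD\<close>, where \<open>w = 3\<close>, and at most 3 + 3
  letters for \<open>xyzx . y^R . z^R\<close> in \<open>wordF\<close>, where \<open>w = 7\<close>.
  If the congruences involve nearly twice the length of the factor, as for
  \<open>xyzyx . zyxyz\<close>, \<open>e = 2\<close> is taken. Some formulas repeat only images that
  may be short compared with their distance. Then the argument is read backwards: a factor repeated
  at a distance with known power of two avoids the letters changed by that shift, which bounds the
  factor and also locates it. For the lower bounds, two-sided extendability passes to factors, which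
  is what justifies pruning, and lets a tree grow on the side where it dies sooner.\<close>

definition occ_at :: "(nat \<Rightarrow> 'a) \<Rightarrow> nat \<Rightarrow> 'a list \<Rightarrow> bool" where
  "occ_at D i u \<longleftrightarrow> (\<forall>s<length u. D (i + s) = u ! s)"

definition factor :: "(nat \<Rightarrow> 'a) \<Rightarrow> 'a list \<Rightarrow> bool" where
  "factor D u \<longleftrightarrow> (\<exists>i. occ_at D i u)"

fun img :: "('v \<Rightarrow> 'a list) \<Rightarrow> 'v letter \<Rightarrow> 'a list" where
  "img h (Var x) = h x"
| "img h (Rev x) = rev (h x)"

lemma occ_at_eq: "occ_at D i u \<longleftrightarrow> map D [i..<i + length u] = u"
  unfolding occ_at_def list_eq_iff_nth_eq by auto

lemma occ_at_append:
  "occ_at D i (u @ v) \<longleftrightarrow> occ_at D i u \<and> occ_at D (i + length u) v"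
proof -
  have "map D [i..<i + length (u @ v)] =
      map D [i..<i + length u] @ map D [i + length u..<i + length u + length v]"
    using upt_add_eq_append[of i "i + length u" "length v"] by (simp add: add.assoc)
  then show ?thesis unfolding occ_at_eq by (simp only: append_eq_append_conv length_map length_upt) simp
qed

lemma morphism_concat:
  assumes "morphism f"
  shows "f p = concat (map (\<lambda>c. f [c]) p)"
proof (induction p)
  case Nil
  have "f ([] @ []) = f [] @ f []" using assms unfolding morphism_def by blast
  then show ?case by simp
next
  case (Cons c p)
  have "f ([c] @ p) = f [c] @ f p" using assms unfolding morphism_def by blast
  then show ?case using Cons.IH by simp
qed

text \<open>A morphism is determined by its values on letters, and respecting reversal leaves only
  those on the letters \<open>Var x\<close> free. Variables absent from the formula still need a
  nonempty image.\<close>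

lemma occurs_iff:
  "occurs \<phi> w \<longleftrightarrow> (\<exists>h. (\<forall>x. h x \<noteq> []) \<and> (\<forall>p. p |\<in>| \<phi> \<longrightarrow> sublist (concat (map (img h) p)) w))"
proof
  assume "occurs \<phi> w"
  then obtain f where f: "morphism f" "nonerasing f" "respects_reversal f"
    "\<forall>p. p |\<in>| \<phi> \<longrightarrow> sublist (f p) w" unfolding occurs_def by blast
  define h where "h x = f [Var x]" for x
  have "f [c] = img h c" for c
    using f(3) unfolding respects_reversal_def h_def by (cases c) simp_all
  then have "(\<lambda>c. f [c]) = img h" by (rule ext)
  then have "f p = concat (map (img h) p)" for p
    using morphism_concat[OF f(1), of p] by (simp only:)
  then have "\<forall>p. p |\<in>| \<phi> \<longrightarrow> sublist (concat (map (img h) p)) w"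
    using f(4) by (simp only:)
  moreover have "\<forall>x. h x \<noteq> []" using f(2) unfolding nonerasing_def h_def by simp
  ultimately show "\<exists>h. (\<forall>x. h x \<noteq> []) \<and> (\<forall>p. p |\<in>| \<phi> \<longrightarrow> sublist (concat (map (img h) p)) w)"
    by blast
next
  assume "\<exists>h. (\<forall>x. h x \<noteq> []) \<and> (\<forall>p. p |\<in>| \<phi> \<longrightarrow> sublist (concat (map (img h) p)) w)"
  then obtain h where h: "\<forall>x. h x \<noteq> []"
    "\<forall>p. p |\<in>| \<phi> \<longrightarrow> sublist (concat (map (img h) p)) w" by blast
  have ne: "img h c \<noteq> []" for c using h(1) by (cases c) simp_all
  define f where "f p = concat (map (img h) p)" for p
  have "morphism f" unfolding morphism_def f_def by simp
  moreover have "nonerasing f" unfolding nonerasing_def f_def 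
  proof (intro allI impI)
    fix p :: "'a letter list" assume "p \<noteq> []"
    then show "concat (map (img h) p) \<noteq> []" using ne by (cases p) simp_all
  qed
  moreover have "respects_reversal f" unfolding respects_reversal_def f_def by simp
  moreover have "\<forall>p. p |\<in>| \<phi> \<longrightarrow> sublist (f p) w" using h(2) unfolding f_def .
  ultimately show "occurs \<phi> w" unfolding occurs_def by blast
qed

lemma sublist_prefix_factor: "sublist u (map D [0..<N]) \<Longrightarrow> factor D u"
proof -
  assume "sublist u (map D [0..<N])"
  then obtain p s where "map D [0..<N] = p @ u @ s" unfolding sublist_def by blast
  moreover have "occ_at D 0 (map D [0..<N])" by (simp add: occ_at_eq)
  ultimately show "factor D u" unfolding factor_def by (metis occ_at_append)
qed

text \<open>The prefixes of one infinite word are infinitely many finite words, and a factor of a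
  prefix is a factor of \<open>D\<close>.\<close>

lemma avoidableI:
  fixes D :: "nat \<Rightarrow> nat"
  assumes D: "\<And>n. D n < k"
    and no: "\<And>h. (\<And>x. h x \<noteq> []) \<Longrightarrow> (\<And>p. p |\<in>| \<phi> \<Longrightarrow> factor D (concat (map (img h) p))) \<Longrightarrow> False"
  shows "avoidable k \<phi>"
proof -
  let ?w = "\<lambda>N. map D [0..<N]"
  have "avoids (?w N) \<phi>" for N
    unfolding avoids_def occurs_iff
  proof (rule notI, elim exE conjE)
    fix h assume "\<forall>x. h x \<noteq> []"
      and "\<forall>p. p |\<in>| \<phi> \<longrightarrow> sublist (concat (map (img h) p)) (?w N)"
    then show False using no[of h] sublist_prefix_factor by blast
  qed
  then have "range ?w \<subseteq> {w \<in> lists {..<k}. avoids w \<phi>}" using D by auto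
  moreover have "infinite (range ?w)"
  proof (rule range_inj_infinite)
    show "inj ?w" by (rule injI) (metis diff_zero length_map length_upt)
  qed
  ultimately show ?thesis unfolding avoidable_def using finite_subset by blast
qed

section \<open>Monotonicity, the avoidability index and mirror images\<close>

lemma avoidable_mono:
  assumes "avoidable k \<phi>" "k \<le> k'"
  shows "avoidable k' \<phi>"
proof -
  have "{w \<in> lists {..<k}. avoids w \<phi>} \<subseteq> {w \<in> lists {..<k'}. avoids w \<phi>}"
    using assms(2) by auto
  then show ?thesis using assms(1) unfolding avoidable_def using finite_subset by blast
qed

lemma avoidability_index_less:
  assumes "avoidable k \<phi>" "k < n"
  shows "avoidability_index \<phi> < enat n"
  using Least_le[of "\<lambda>k. avoidable k \<phi>", OF assms(1)] assms
  unfolding avoidability_index_def by auto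

lemma avoidability_index_eq:
  assumes "avoidable (Suc k) \<phi>" "\<not> avoidable k \<phi>"
  shows "avoidability_index \<phi> = enat (Suc k)"
proof -
  have "(LEAST k. avoidable k \<phi>) = Suc k"
  proof (rule Least_equality[where P = "\<lambda>k. avoidable k \<phi>"])
    show "avoidable (Suc k) \<phi>" by fact
    show "Suc k \<le> m" if "avoidable m \<phi>" for m
      using that assms(2) avoidable_mono[of m \<phi> k] by (meson not_less_eq_eq)
  qed
  then show ?thesis unfolding avoidability_index_def using assms(1) by auto
qed

text \<open>Only the order of letters within the fragments is reversed; \<open>Var\<close> and
  \<open>Rev\<close> are not exchanged. Reversing all images \<open>h x\<close> reverses the image
  of either kind of letter.\<close>

lemma occurs_mirror:
  assumes "occurs \<phi> w"
  shows "occurs (rev |`| \<phi>) (rev w)"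
proof -
  obtain h where h: "\<And>x. h x \<noteq> []" "\<And>p. p |\<in>| \<phi> \<Longrightarrow> sublist (concat (map (img h) p)) w"
    using assms unfolding occurs_iff by blast
  let ?h = "\<lambda>x. rev (h x)"
  have im: "img ?h c = rev (img h c)" for c by (cases c) auto
  have cm: "concat (map (img ?h) (rev p)) = rev (concat (map (img h) p))" for p
    by (induction p) (auto simp: im)
  have "sublist (concat (map (img ?h) q)) (rev w)" if q: "q |\<in>| rev |`| \<phi>" for q
  proof -
    obtain p where "p |\<in>| \<phi>" "q = rev p" using q by blast
    then show ?thesis using h(2)[of p] cm[of p] by simp
  qed
  then show ?thesis unfolding occurs_iff using h(1) by (intro exI[of _ ?h]) simp
qed

lemma avoids_mirror: "avoids (rev w) (rev |`| \<phi>) \<longleftrightarrow> avoids w \<phi>"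
proof -
  have "rev |`| (rev |`| \<phi>) = \<phi>" by (simp add: fset_eq_iff fimage_iff image_image)
  then show ?thesis
    unfolding avoids_def using occurs_mirror[of \<phi> w] occurs_mirror[of "rev |`| \<phi>" "rev w"]
    by (metis rev_rev_ident)
qed

lemma avoidable_mirror:
  assumes "avoidable k \<phi>"
  shows "avoidable k (rev |`| \<phi>)"
proof -
  have "rev ` {w \<in> lists {..<k}. avoids w \<phi>} \<subseteq> {w \<in> lists {..<k}. avoids w (rev |`| \<phi>)}"
    by (auto simp: avoids_mirror)
  moreover have "infinite (rev ` {w \<in> lists {..<k}. avoids w \<phi>})"
    using assms unfolding avoidable_def by (subst finite_image_iff) auto
  ultimately show ?thesis unfolding avoidable_def using finite_subset by blast
qed

section \<open>Periodic words\<close>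

lemma periodic_cong:
  assumes "occ_at (\<lambda>n. n mod m) i u" "occ_at (\<lambda>n. n mod m) j u" "u \<noteq> []"
  shows "i mod m = j mod (m :: nat)"
proof -
  have "0 < length u" using assms(3) by simp
  then have "(i + 0) mod m = u ! 0" "(j + 0) mod m = u ! 0"
    using assms(1,2) unfolding occ_at_def by blast+
  then show ?thesis by simp
qed

text \<open>From \<open>u ! 0\<close> to \<open>u ! 1\<close> the residue grows by one; in
  \<open>rev u\<close> it grows by one from \<open>u ! 1\<close> to \<open>u ! 0\<close> as well. So
  two letters would force \<open>m\<close> to divide 2.\<close>

lemma periodic_rev:
  assumes u: "occ_at (\<lambda>n. n mod m) i u" "occ_at (\<lambda>n. n mod m) j (rev u)" and "u \<noteq> []" and m: "3 \<le> (m :: nat)"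
  shows "length u = 1"
proof (rule ccontr)
  assume "length u \<noteq> 1"
  then have l: "2 \<le> length u" using assms(3) by (cases u) (auto simp: Suc_le_eq)
  \<comment> \<open>The last two letters of \<open>rev u\<close> stand at \<open>?k\<close> and
    \<open>Suc ?k\<close>.\<close>
  let ?k = "j + (length u - 2)"
  note u1 = u(1)[unfolded occ_at_def, rule_format] and u2 = u(2)[unfolded occ_at_def length_rev, rule_format]
  have i: "(i + 0) mod m = u ! 0" "(i + 1) mod m = u ! 1"
    by (rule u1, use l in linarith)+
  have "?k mod m = rev u ! (length u - 2)" by (rule u2) (use l in linarith)
  also have "\<dots> = u ! 1" using l by (simp add: rev_nth Suc_diff_le numeral_2_eq_2)
  finally have k: "?k mod m = Suc i mod m" using i by simp
  have "(j + (length u - 1)) mod m = rev u ! (length u - 1)" by (rule u2) (use l in linarith)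
  also have "\<dots> = u ! 0" using l by (simp add: rev_nth)
  finally have "(j + (length u - 1)) mod m = i mod m" using i by simp
  moreover have "j + (length u - 1) = Suc ?k" using l by linarith
  ultimately have "Suc ?k mod m = i mod m" by (simp only:)
  then have "Suc (Suc i) mod m = i mod m" using k by (metis mod_Suc_eq)
  then have "m dvd 2" using mod_eq_dvd_iff_nat[of i "Suc (Suc i)" m] by simp
  then show False using m by (auto dest: dvd_imp_le)
qed

text \<open>In the word with period \<open>m\<close>, the positions modulo \<open>m\<close> of the images of the letters and
  the lengths of the images of the variables satisfy the following constraints, as images whose
  reversals occur are single letters.\<close>

definition compatible :: "nat \<Rightarrow> 'v formula \<Rightarrow> ('v letter \<Rightarrow> nat) \<Rightarrow> ('v \<Rightarrow> nat) \<Rightarrow> bool" where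
  "compatible m \<phi> \<rho> l \<longleftrightarrow> (\<forall>c. \<rho> c < m) \<and>
     (\<forall>p\<in>fset \<phi>. case p of [c, d] \<Rightarrow> (\<rho> c + l (case c of Var x \<Rightarrow> x | Rev x \<Rightarrow> x)) mod m = \<rho> d | _ \<Rightarrow> True) \<and>
     (\<forall>x. (\<exists>p\<in>fset \<phi>. Var x \<in> set p) \<and> (\<exists>p\<in>fset \<phi>. Rev x \<in> set p) \<longrightarrow>
        l x = 1 \<and> \<rho> (Rev x) = \<rho> (Var x))"

text \<open>An occurrence in the periodic word yields a solution of the linear constraints, so it
  suffices that they have none.\<close>

lemma avoidable_periodic:
  fixes \<phi> :: "'v formula"
  assumes m: "3 \<le> m" and no: "\<And>\<rho> l. \<not> compatible m \<phi> \<rho> l"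
  shows "avoidable m \<phi>"
proof (rule avoidableI[of "\<lambda>n. n mod m"])
  let ?D = "\<lambda>n. n mod m"
  show "n mod m < m" for n using m by simp
  fix h :: "'v \<Rightarrow> nat list"
  assume ne: "\<And>x. h x \<noteq> []" and f: "\<And>p. p |\<in>| \<phi> \<Longrightarrow> factor ?D (concat (map (img h) p))"
  \<comment> \<open>The choice is harmless: all occurrences of a nonempty word start at the same
    residue. Letters absent from the formula get an arbitrary residue.\<close>
  define \<rho> where "\<rho> c = (SOME i. occ_at ?D i (img h c)) mod m" for c
  have im: "img h c \<noteq> []" for c using ne by (cases c) simp_all
  have \<rho>: "\<rho> c = i mod m" if "occ_at ?D i (img h c)" for i c
    unfolding \<rho>_def using someI[of "\<lambda>i. occ_at ?D i (img h c)", OF that] that im by (rule periodic_cong)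
  have occ: "\<exists>i. occ_at ?D i (img h c)" if "p \<in> fset \<phi>" "c \<in> set p" for p c
  proof -
    obtain p1 p2 where "p = p1 @ c # p2" using split_list[OF \<open>c \<in> set p\<close>] by blast
    then have "factor ?D (concat (map (img h) p1) @ img h c @ concat (map (img h) p2))"
      using f[OF that(1)] by simp
    then show ?thesis unfolding factor_def occ_at_append by blast
  qed
  have "compatible m \<phi> \<rho> (\<lambda>x. length (h x))"
    unfolding compatible_def
  proof (intro conjI allI ballI impI)
    show "\<rho> c < m" for c using m unfolding \<rho>_def by simp
  next
    fix p assume p: "p \<in> fset \<phi>"
    have "(\<rho> c + length (h (case c of Var x \<Rightarrow> x | Rev x \<Rightarrow> x))) mod m = \<rho> d" if cd: "p = [c, d]" for c d
    proof -
      have "factor ?D (img h c @ img h d)" using f[OF p] cd by simp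
      then obtain i where i: "occ_at ?D i (img h c)" "occ_at ?D (i + length (img h c)) (img h d)"
        unfolding factor_def occ_at_append by blast
      have "length (h (case c of Var x \<Rightarrow> x | Rev x \<Rightarrow> x)) = length (img h c)" by (cases c) simp_all
      then show ?thesis using \<rho>[OF i(1)] \<rho>[OF i(2)] by (simp add: mod_add_left_eq)
    qed
    then show "case p of [c, d] \<Rightarrow> (\<rho> c + length (h (case c of Var x \<Rightarrow> x | Rev x \<Rightarrow> x))) mod m = \<rho> d
        | _ \<Rightarrow> True"
      by (simp split: list.split)
  next
    fix x assume "(\<exists>p\<in>fset \<phi>. Var x \<in> set p) \<and> (\<exists>p\<in>fset \<phi>. Rev x \<in> set p)"
    then obtain i j where i: "occ_at ?D i (img h (Var x))" and j: "occ_at ?D j (img h (Rev x))"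
      using occ by meson
    have l: "length (h x) = 1" using periodic_rev[of m i "h x" j] i j ne m by simp
    then have "img h (Rev x) = img h (Var x)" by (cases "h x") simp_all
    then show "length (h x) = 1" "\<rho> (Rev x) = \<rho> (Var x)" using l \<rho>[OF i] \<rho>[of i "Rev x"] i by simp_all
  qed
  then show False using no by blast
qed

lemma all_var: "(\<forall>x. P x) \<longleftrightarrow> P vx \<and> P vy \<and> P vz"
  by (metis var.exhaust)

text \<open>The last letter of \<open>h vx\<close> would be followed by a copy of itself, which
  never happens in \<open>0101...\<close>. The period 2 is too small for
  \<open>avoidable_periodic\<close>.\<close>

lemma avoidable_xx_rev: "avoidable 2 {|[X,XR]|}"
proof (rule avoidableI[of "\<lambda>n. n mod 2"])
  show "n mod 2 < (2 :: nat)" for n by simp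
  fix h :: "var \<Rightarrow> nat list"
  assume ne: "\<And>x. h x \<noteq> []" and f: "\<And>p. p |\<in>| {|[X,XR]|} \<Longrightarrow> factor (\<lambda>n. n mod 2) (concat (map (img h) p))"
  have l: "0 < length (h vx)" using ne by simp
  have "factor (\<lambda>n. n mod 2) (h vx @ rev (h vx))" using f[of "[X,XR]"] by simp
  then obtain i where i: "occ_at (\<lambda>n. n mod 2) i (h vx)" "occ_at (\<lambda>n. n mod 2) (i + length (h vx)) (rev (h vx))"
    unfolding factor_def occ_at_append by blast
  define k where "k = i + (length (h vx) - 1)"
  have k: "k mod 2 = h vx ! (length (h vx) - 1)" using i(1) l unfolding occ_at_def k_def by simp
  have "(i + length (h vx) + 0) mod 2 = rev (h vx) ! 0"
    using i(2) l unfolding occ_at_def length_rev by blast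
  moreover have "Suc k = i + length (h vx)" using l unfolding k_def by simp
  ultimately have "Suc k mod 2 = h vx ! (length (h vx) - 1)" using l by (simp add: rev_nth)
  then have "k mod 2 = Suc k mod 2" using k by simp
  then show False by presburger
qed

text \<open>All lengths are forced to be 1, and going from \<open>x\<close> to \<open>y\<close> and
  back gives 2 = 0 modulo 3.\<close>

lemma avoidable_periodic_3:
  "avoidable 3 {|[X,Y], [Y,X], [XR], [YR]|}"
  "avoidable 3 {|[X,Y], [Y,XR], [YR]|}"
  "avoidable 3 {|[X,Y], [YR,XR]|}"
  by (rule avoidable_periodic, simp,
      auto simp: compatible_def all_var mod_Suc split: if_splits)+

text \<open>The constraints give 1 = 0 or, for the four formulas in which \<open>x\<close>,
  \<open>y\<close>, \<open>z\<close> follow each other cyclically, 3 = 0. The latter is why the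
  period is 4 and not 3.\<close>

lemma avoidable_periodic_4:
  "avoidable 4 {|[X,Y], [X,Z], [YR,Z]|}"
  "avoidable 4 {|[X,YR], [Y,ZR], [Z,XR]|}"
  "avoidable 4 {|[X,Y], [X,Z], [Y,Z], [YR]|}"
  "avoidable 4 {|[X,Y], [X,Z], [YR,ZR]|}"
  "avoidable 4 {|[Y,X], [Z,X], [ZR,YR]|}"
  "avoidable 4 {|[X,Y], [X,Z], [Y,ZR], [YR]|}"
  "avoidable 4 {|[Y,X], [Z,X], [ZR,Y], [YR]|}"
  "avoidable 4 {|[X,Y], [XR,ZR], [Y,Z], [YR]|}"
  "avoidable 4 {|[X,Y], [XR,ZR], [YR,Z]|}"
  "avoidable 4 {|[X,Y], [Y,Z], [Z,X], [XR], [YR], [ZR]|}"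
  "avoidable 4 {|[X,Y], [Y,Z], [Z,XR], [YR], [ZR]|}"
  "avoidable 4 {|[X,Y], [Y,Z], [ZR,XR], [YR]|}"
  by (rule avoidable_periodic, simp,
      auto simp: compatible_def all_var mod_Suc split: if_splits)+

section \<open>Generalized paperfolding words\<close>

text \<open>In binary, the trailing ones of \<open>t\<close> and the zero before them are deleted.
  This leaves the \<open>j\<close> with \<open>t + 1 = 2 ^ k * (2 * j + 1)\<close>.\<close>

function pf :: "nat \<Rightarrow> nat" where
  "pf t = (if even t then t div 2 else pf (t div 2))"
  by auto
termination by (relation "measure id") (auto elim: oddE)

declare pf.simps [simp del]

lemma pf_eq: "pf (2 ^ k * (2 * j + 1) - 1) = j"
proof (induction k)
  case 0
  then show ?case by (simp add: pf.simps)
next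
  case (Suc k)
  define m where "m = 2 ^ k * (2 * j + 1)"
  have "m > 0" unfolding m_def by simp
  then have "2 * m - 1 = Suc (2 * (m - 1))" by simp
  then have "2 ^ Suc k * (2 * j + 1) - 1 = Suc (2 * (m - 1))" unfolding m_def by (simp add: mult.assoc)
  moreover have "pf (Suc (2 * (m - 1))) = pf (m - 1)" by (subst pf.simps) simp
  ultimately show ?case using Suc unfolding m_def by simp
qed

text \<open>Even \<open>t\<close> means \<open>k = 0\<close>, so \<open>A\<close> serves exponent 0
  and \<open>B\<close> all positive exponents. With \<open>q = e = 1\<close> and
  \<open>A = B = [[0], [1]]\<close> this is the ordinary paperfolding word.\<close>

definition pfword :: "nat list list \<Rightarrow> nat list list \<Rightarrow> nat \<Rightarrow> nat \<Rightarrow> nat \<Rightarrow> nat" where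
  "pfword A B e q n =
     (if even (n div q) then A else B) ! (pf (n div q) mod 2 ^ e) ! (n mod q)"

fun block_strings :: "nat list list \<Rightarrow> nat list list \<Rightarrow> nat \<Rightarrow> nat \<Rightarrow> nat \<Rightarrow> nat list list" where
  "block_strings A B e 0 u = [[]]"
| "block_strings A B e (Suc M) u =
     [b @ s. b \<leftarrow> (if even u then [A ! (u div 2 mod 2 ^ e)] else remdups B), s \<leftarrow> block_strings A B e M (Suc u)]"

text \<open>Each window carries its position modulo \<open>q * 2 ^ Suc e\<close>.\<close>

definition windows :: "nat list list \<Rightarrow> nat list list \<Rightarrow> nat \<Rightarrow> nat \<Rightarrow> nat \<Rightarrow> nat \<Rightarrow> (nat \<times> nat list) list" where
  "windows A B e q M l =
     [(q * u + r, take l (drop r s)). u \<leftarrow> [0..<2 ^ Suc e], s \<leftarrow> block_strings A B e M u, r \<leftarrow> [0..<q]]"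

definition agree :: "(nat \<Rightarrow> 'a) \<Rightarrow> nat \<Rightarrow> nat \<Rightarrow> nat \<Rightarrow> bool" where
  "agree D i j l \<longleftrightarrow> (\<forall>s<l. D (i + s) = D (j + s))"

lemma agree_occ_at:
  "occ_at D i u \<Longrightarrow> occ_at D j u \<Longrightarrow> agree D i j (length u)"
  unfolding agree_def occ_at_def by simp

lemma agree_map: "agree D i j l \<longleftrightarrow> map D [i..<i + l] = map D [j..<j + l]"
  unfolding agree_def by (auto simp: list_eq_iff_nth_eq)

lemma agree_sym: "agree D i j l \<Longrightarrow> agree D j i l"
  unfolding agree_def by simp

locale pf_shape =
  fixes A B :: "nat list list" and e q :: nat and D :: "nat \<Rightarrow> nat"
  assumes q: "0 < q" and e: "0 < e"
    and len: "length A = 2 ^ e" "length B = 2 ^ e" "\<forall>b\<in>set A \<union> set B. length b = q"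
  defines "D \<equiv> pfword A B e q"
begin

lemma block: "map D [q * t..<q * t + q] = (if even t then A else B) ! (pf t mod 2 ^ e)"
    (is "_ = ?b")
proof (rule nth_equalityI)
  have "?b \<in> set A \<union> set B" using len by auto
  then have b: "length ?b = q" using len by auto
  then show "length (map D [q * t..<q * t + q]) = length ?b" by simp
  fix i assume "i < length (map D [q * t..<q * t + q])"
  then have "i < q" by simp
  then show "map D [q * t..<q * t + q] ! i = ?b ! i"
    using q unfolding D_def pfword_def by simp
qed

lemma block_strings:
  "[u = t] (mod 2 ^ Suc e) \<Longrightarrow> map D [q * t..<q * t + q * M] \<in> set (block_strings A B e M u)"
proof (induction M arbitrary: u t)
  case 0
  then show ?case by simp
next
  case (Suc M)
  let ?b = "(if even t then A else B) ! (pf t mod 2 ^ e)"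
  have "map D [q * t..<q * t + q * Suc M] =
      map D [q * t..<q * t + q] @ map D [q * Suc t..<q * Suc t + q * M]"
    using upt_add_eq_append[of "q * t" "q * t + q" "q * M"] by (simp add: algebra_simps)
  moreover have "map D [q * Suc t..<q * Suc t + q * M] \<in> set (block_strings A B e M (Suc u))"
  proof (rule Suc.IH)
    show "[Suc u = Suc t] (mod 2 ^ Suc e)"
      using Suc.prems cong_add_rcancel_nat[of u 1 t "2 ^ Suc e"] by simp
  qed
  moreover have "?b \<in> set (if even u then [A ! (u div 2 mod 2 ^ e)] else remdups B)"
  proof -
    have ev: "even u \<longleftrightarrow> even t"
      using cong_dvd_modulus_nat[OF Suc.prems, of 2] cong_dvd_iff[of u t 2] by simp
    show ?thesis
    proof (cases "even t")
      case True
      have half: "v mod 2 ^ Suc e div 2 = v div 2 mod 2 ^ e" for v :: nat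
        using mod_mult2_eq[of v 2 "2 ^ e"] by simp
      have "u div 2 mod 2 ^ e = t div 2 mod 2 ^ e"
        using half[of u] half[of t] Suc.prems unfolding cong_def by simp
      then show ?thesis using ev True by (simp add: pf.simps)
    next
      case False
      then show ?thesis using ev len by simp
    qed
  qed
  ultimately show ?case using block[of t] by auto
qed

text \<open>A window starts at offset at most \<open>q - 1\<close> in its first block; the bound on
  \<open>l\<close> says that it then still fits into \<open>M\<close> blocks.\<close>

lemma windows:
  assumes l: "l + q \<le> q * M + 1"
  shows "\<exists>x. (x, map D [n..<n + l]) \<in> set (windows A B e q M l) \<and> [x = n] (mod q * 2 ^ Suc e)"
proof -
  define t r u where "t = n div q" and "r = n mod q" and "u = t mod 2 ^ Suc e"
  have n: "n = q * t + r" and r: "r < q" unfolding t_def r_def using q by simp_all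
  define s where "s = map D [q * t..<q * t + q * M]"
  have "s \<in> set (block_strings A B e M u)"
    unfolding s_def by (rule block_strings) (simp add: u_def)
  moreover have "take l (drop r s) = map D [n..<n + l]"
    using l r unfolding s_def n by (intro nth_equalityI) (auto simp: add.assoc)
  ultimately have "(q * u + r, map D [n..<n + l]) \<in> set (windows A B e q M l)"
    unfolding windows_def set_concat set_map using r
    by (intro UN_I[OF imageI[of u]] UN_I[OF imageI[of s]]) (auto simp: u_def intro!: bexI[of _ s])
  moreover have "[q * u + r = n] (mod q * 2 ^ Suc e)"
    unfolding n u_def by (intro cong_add_rcancel_nat[THEN iffD2]) (simp add: cong_def mod_mult_mult1)
  ultimately show ?thesis by blast
qed

end

section \<open>From differences between blocks to congruences between positions\<close>

definition synced :: "(nat \<times> nat list) list \<Rightarrow> nat \<Rightarrow> bool" where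
  "synced W m \<longleftrightarrow> (\<forall>(x, u)\<in>set W. \<forall>(y, v)\<in>set W. u = v \<longrightarrow> x mod m = y mod m)"

text \<open>The half-turn of the index modulo \<open>2 ^ e\<close> is the effect of the shifts in
  \<open>mismatch\<close>.\<close>

definition differ :: "nat list list \<Rightarrow> nat \<Rightarrow> nat \<Rightarrow> nat \<Rightarrow> bool" where
  "differ A e r w \<longleftrightarrow> (\<forall>j<2 ^ e. \<forall>s<w. A ! j ! (r + s) \<noteq> A ! ((j + 2 ^ (e - 1)) mod 2 ^ e) ! (r + s))"

text \<open>\<open>r0\<close> and \<open>w\<close> describe the run of offsets at which the
  half-turn changes the letter. \<open>L\<close> is the length from which a factor fixes its
  position modulo \<open>q * 2 ^ e\<close>; this base case is checked on windows within
  \<open>M\<close> blocks.\<close>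

locale pf_word = pf_shape +
  fixes r0 w L M :: nat
  assumes w: "0 < w" "r0 + w \<le> q"
    and differ: "differ A e r0 w" "differ B e r0 w"
    and M: "L + q \<le> q * M + 1"
    and sync: "synced (windows A B e q M L) (q * 2 ^ e)"
begin

text \<open>The first condition says that \<open>2 ^ k\<close> is the exact power of two in
  \<open>Suc (n div q)\<close>; the others select the changed offsets.\<close>

definition hit :: "nat \<Rightarrow> nat \<Rightarrow> bool" where
  "hit k n \<longleftrightarrow> Suc (n div q) mod 2 ^ Suc k = 2 ^ k \<and> r0 \<le> n mod q \<and> n mod q < r0 + w"

lemma hit_cong:
  assumes "[n = n'] (mod q * 2 ^ Suc k)"
  shows "hit k n \<longleftrightarrow> hit k n'"
proof -
  have c: "n mod (q * 2 ^ Suc k) = n' mod (q * 2 ^ Suc k)" using assms unfolding cong_def .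
  have "v mod (q * 2 ^ Suc k) mod q = v mod q" for v :: nat
    by (simp add: mod_mod_cancel)
  then have "n mod q = n' mod q" using c by metis
  moreover have "v mod (q * 2 ^ Suc k) div q = v div q mod 2 ^ Suc k" for v :: nat
    using mod_mult2_eq[of v q "2 ^ Suc k"] q by simp
  then have "n div q mod 2 ^ Suc k = n' div q mod 2 ^ Suc k" using c by metis
  then have "Suc (n div q) mod 2 ^ Suc k = Suc (n' div q) mod 2 ^ Suc k" by (metis mod_Suc_eq)
  ultimately show ?thesis unfolding hit_def by simp
qed

lemma hit_run: "\<exists>s<q * 2 ^ Suc k. \<forall>t<w. hit k (i + s + t)"
proof -
  let ?N = "q * 2 ^ Suc k"
  \<comment> \<open>Block \<open>2 ^ k - 1\<close> is the first one with exponent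
    \<open>k\<close>.\<close>
  let ?p = "q * (2 ^ k - 1) + r0"
  have N: "0 < ?N" using q by simp
  have "\<exists>s<?N. [i + s = ?p] (mod ?N)"
  proof -
    \<comment> \<open>Solves \<open>i + s = ?p\<close> modulo \<open>?N\<close>; the complement
      \<open>?N - i mod ?N\<close> stands for \<open>- i\<close>.\<close>
    let ?s = "(?p + (?N - i mod ?N)) mod ?N"
    have "[i + ((c + (n - i mod n)) mod n) = c] (mod n)" if "0 < n" for n c :: nat
    proof -
      have "[i + ((c + (n - i mod n)) mod n) = i mod n + (c + (n - i mod n))] (mod n)"
        by (simp add: cong_def mod_simps)
      moreover have "i mod n + (c + (n - i mod n)) = c + n"
        using mod_less_divisor[OF that, of i] by linarith
      ultimately show ?thesis by (simp add: cong_def)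
    qed
    then show ?thesis using N by (intro exI[of _ ?s]) simp
  qed
  then obtain s where s: "s < ?N" "[i + s = ?p] (mod ?N)" by blast
  have "hit k (i + s + t)" if "t < w" for t
  proof -
    have "[i + s + t = ?p + t] (mod ?N)" using s(2) by (simp add: cong_add_rcancel_nat)
    moreover have "hit k (?p + t)"
    proof -
      have d: "(?p + t) div q = 2 ^ k - 1" "(?p + t) mod q = r0 + t"
        using that w q by (simp_all add: add.assoc)
      then show ?thesis unfolding hit_def using that by simp
    qed
    ultimately show ?thesis using hit_cong by blast
  qed
  then show ?thesis using s(1) by blast
qed

text \<open>Runs of \<open>w\<close> hits recur with period \<open>q * 2 ^ Suc k\<close>, so at most
  \<open>q * 2 ^ Suc k - w\<close> consecutive positions are free of hits.\<close>

lemma hit_in_interval: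
  assumes "q * 2 ^ Suc k < l + w"
  shows "\<exists>s<l. hit k (i + s)"
proof -
  obtain s where s: "s < q * 2 ^ Suc k" "\<And>t. t < w \<Longrightarrow> hit k (i + s + t)"
    using hit_run by blast
  show ?thesis
  proof (cases "s < l")
    case True
    then show ?thesis using s(2)[of 0] w by auto
  next
    case False
    \<comment> \<open>The run starts beyond the interval but has not ended when the period is
      complete, so by periodicity \<open>i\<close> itself is a hit.\<close>
    let ?t = "q * 2 ^ Suc k - s"
    have "q \<le> q * 2 ^ Suc k" by simp
    then have "0 < l" using assms w by linarith
    moreover have "hit k (i + q * 2 ^ Suc k)"
      using s(2)[of ?t] s(1) assms False by (simp add: add.assoc)
    then have "hit k i" using hit_cong[of "i + q * 2 ^ Suc k" i k] by (simp add: cong_def)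
    ultimately show ?thesis by (intro exI[of _ 0]) simp
  qed
qed

text \<open>Shifting \<open>t\<close> by \<open>2 ^ (k + e) * m\<close> adds
  \<open>2 ^ (e - 1) * m\<close> to \<open>j\<close>, and for odd \<open>m\<close> this is the
  half-turn modulo \<open>2 ^ e\<close>. The parity of \<open>t\<close>, which selects
  \<open>A\<close> or \<open>B\<close>, is kept because \<open>e > 0\<close>.\<close>

lemma mismatch:
  assumes h: "hit k n" and m: "odd m"
  shows "D n \<noteq> D (n + q * 2 ^ (k + e) * m)"
proof -
  define t r j where "t = n div q" and "r = n mod q" and "j = Suc t div 2 ^ Suc k"
  have r: "r0 \<le> r" "r < r0 + w" using h unfolding hit_def r_def by auto
  have pow: "(2 :: nat) ^ (k + e) = 2 ^ Suc k * 2 ^ (e - 1)" using e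
    by (cases e) (simp_all add: power_add)
  have "Suc t = 2 ^ Suc k * j + 2 ^ k"
    using h mult_div_mod_eq[of "2 ^ Suc k" "Suc t"] unfolding hit_def j_def t_def by simp
  then have St: "Suc t = 2 ^ k * (2 * j + 1)" by (simp add: algebra_simps)
  then have pt: "pf t = j" using pf_eq[of k j] by (metis diff_Suc_1)
  have "Suc (t + 2 ^ (k + e) * m) = 2 ^ k * (2 * (j + 2 ^ (e - 1) * m) + 1)"
    using St unfolding pow by (simp add: algebra_simps)
  then have pt': "pf (t + 2 ^ (k + e) * m) = j + 2 ^ (e - 1) * m"
    using pf_eq[of k "j + 2 ^ (e - 1) * m"] by (metis diff_Suc_1)
  have "(2 ^ (e - 1) * m) mod 2 ^ e = 2 ^ (e - 1)"
  proof -
    obtain c where "m = 2 * c + 1" using m by (elim oddE)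
    then have "2 ^ (e - 1) * m = 2 ^ (e - 1) + 2 ^ e * c"
      using e by (cases e) (simp_all add: algebra_simps)
    then show ?thesis using e by simp
  qed
  then have J: "(j + 2 ^ (e - 1) * m) mod 2 ^ e = (j mod 2 ^ e + 2 ^ (e - 1)) mod 2 ^ e"
    using mod_add_eq[of j "2 ^ e" "2 ^ (e - 1) * m"] by (simp add: mod_simps)
  have n': "(n + q * 2 ^ (k + e) * m) div q = t + 2 ^ (k + e) * m"
      "(n + q * 2 ^ (k + e) * m) mod q = r"
    unfolding t_def r_def using q div_mult_self2[of q n "2 ^ (k + e) * m"] mod_mult_self2[of n q "2 ^ (k + e) * m"]
    by (simp_all add: mult.assoc)
  have "even (t + 2 ^ (k + e) * m) \<longleftrightarrow> even t" using e by simp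
  moreover have "X ! (j mod 2 ^ e) ! r \<noteq> X ! ((j mod 2 ^ e + 2 ^ (e - 1)) mod 2 ^ e) ! r"
    if "differ X e r0 w" for X
    using that[unfolded differ_def, rule_format, of "j mod 2 ^ e" "r - r0"] r by simp
  ultimately show ?thesis
    unfolding D_def pfword_def n' t_def[symmetric] r_def[symmetric] pt pt' J
    using differ by (cases "even t") simp_all
qed

lemma agree_base:
  assumes "agree D i j l" "L \<le> l"
  shows "[i = j] (mod q * 2 ^ e)"
proof -
  have "map D [i..<i + L] = map D [j..<j + L]"
    using assms unfolding agree_map[symmetric] by (simp add: agree_def)
  moreover obtain x y where
    "(x, map D [i..<i + L]) \<in> set (windows A B e q M L)" and x: "[x = i] (mod q * 2 ^ Suc e)" and
    "(y, map D [j..<j + L]) \<in> set (windows A B e q M L)" and y: "[y = j] (mod q * 2 ^ Suc e)"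
    using windows[OF M, of i] windows[OF M, of j] by blast
  ultimately have "[x = y] (mod q * 2 ^ e)"
    using sync unfolding synced_def cong_def by fastforce
  moreover have "q * 2 ^ e dvd q * 2 ^ Suc e" by simp
  ultimately show ?thesis using x y by (meson cong_dvd_modulus_nat cong_sym cong_trans)
qed

lemma agree_cong_less:
  assumes "agree D i j l" "L \<le> l" "q * 2 ^ k < l + w" "i \<le> j"
  shows "[i = j] (mod q * 2 ^ (k + e))"
  using assms(3)
proof (induction k)
  case 0
  show ?case using agree_base[OF assms(1,2)] by simp
next
  case (Suc k)
  have "q * 2 ^ k \<le> q * 2 ^ Suc k" by simp
  then have "q * 2 ^ k < l + w" using Suc.prems by linarith
  then have "q * 2 ^ (k + e) dvd j - i"
    using Suc.IH cong_altdef_nat[OF assms(4)] cong_sym by blast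
  then obtain m where "j - i = q * 2 ^ (k + e) * m" by (elim dvdE)
  then have m: "j = i + q * 2 ^ (k + e) * m" using assms(4) by linarith
  obtain s where s: "s < l" "hit k (i + s)" using hit_in_interval[OF Suc.prems] by blast
  have "even m"
  proof (rule ccontr)
    assume "odd m"
    then have "D (i + s) \<noteq> D (i + s + q * 2 ^ (k + e) * m)" by (rule mismatch[OF s(2)])
    then show False using assms(1) s(1) unfolding agree_def m by (simp add: ac_simps)
  qed
  then obtain c where "m = 2 * c" by blast
  then have "j = i + q * 2 ^ (Suc k + e) * c" using m by simp
  then show ?case by (simp add: cong_def)
qed

lemma agree_cong:
  assumes "agree D i j l" "L \<le> l" "q * 2 ^ k < l + w"
  shows "[i = j] (mod q * 2 ^ (k + e))"
proof (cases "i \<le> j")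
  case True
  then show ?thesis using agree_cong_less assms by blast
next
  case False
  then show ?thesis using agree_cong_less[OF agree_sym[OF assms(1)]] assms by (simp add: cong_sym)
qed

text \<open>For the largest \<open>k\<close> with \<open>q * 2 ^ k < l + w\<close>, the modulus
  \<open>q * 2 ^ (k + e)\<close> is \<open>2 ^ (e - 1)\<close> times \<open>q * 2 ^ Suc k\<close>,
  and the latter is at least \<open>l + w\<close>. As \<open>N\<close> depends on \<open>l\<close>
  only, several pairs of occurrences share it.\<close>

lemma modulus:
  assumes "L \<le> l" "q < l + w"
  obtains N where "2 ^ (e - 1) * (l + w) \<le> N"
    and "\<And>i j. agree D i j l \<Longrightarrow> [i = j] (mod N)"
proof -
  let ?P = "\<lambda>k. q * 2 ^ k < l + w"
  have "k < 2 ^ k" for k :: nat by simp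
  have bound: "k \<le> l + w" if "?P k" for k
  proof -
    have "k < 2 ^ k" by simp
    also have "2 ^ k \<le> q * 2 ^ k" using q by simp
    finally show ?thesis using that by linarith
  qed
  define k where "k = Greatest ?P"
  have "?P 0" using assms by simp
  then have k: "?P k" unfolding k_def using bound by (rule GreatestI_nat)
  have "\<not> ?P (Suc k)" unfolding k_def using bound Greatest_le_nat[of ?P "Suc (Greatest ?P)" "l + w"] by auto
  then have "2 ^ (e - 1) * (l + w) \<le> 2 ^ (e - 1) * (q * 2 ^ Suc k)" by (intro mult_le_mono) auto
  also have "\<dots> = q * 2 ^ (k + e)" using e by (cases e) (simp_all add: power_add)
  finally show ?thesis using that[of "q * 2 ^ (k + e)"] agree_cong[OF _ assms(1) k] by blast
qed

text \<open>Reads \<open>mismatch\<close> backwards: if the exact power of two in the distance is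
  known, the repeated word lies between hits of level \<open>k\<close>. Unlike
  \<open>modulus\<close>, this also tells where the word lies.\<close>

lemma agree_period:
  assumes "agree D i (i + q * 2 ^ (k + e) * m) l" "odd m"
  shows "\<And>s. s < l \<Longrightarrow> \<not> hit k (i + s)" and "l + w \<le> q * 2 ^ Suc k"
proof -
  show nh: "\<not> hit k (i + s)" if "s < l" for s
    using mismatch[of k "i + s" m] assms that unfolding agree_def by (auto simp: ac_simps)
  show "l + w \<le> q * 2 ^ Suc k" using hit_in_interval[of k l i] nh by force
qed

end

section \<open>Finite search for occurrences with short images\<close>

fun var_of :: "'v letter \<Rightarrow> 'v" where
  "var_of (Var x) = x"
| "var_of (Rev x) = x"

text \<open>Recovers a substitution from the image \<open>v\<close> of a fragment and the lengths of the images of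
  the variables.\<close>

fun decode :: "'v letter list \<Rightarrow> ('v \<Rightarrow> nat) \<Rightarrow> 'a list \<Rightarrow> 'v \<Rightarrow> 'a list" where
  "decode [] ls v = (\<lambda>_. [])"
| "decode (Var x # p) ls v = (decode p ls (drop (ls x) v))(x := take (ls x) v)"
| "decode (Rev x # p) ls v = (decode p ls (drop (ls x) v))(x := rev (take (ls x) v))"

lemma decode:
  assumes "\<forall>c\<in>set p. length (h (var_of c)) = ls (var_of c)" and "x \<in> var_of ` set p"
  shows "decode p ls (concat (map (img h) p) @ s) x = h x"
  using assms
proof (induction p)
  case (Cons d p)
  have l: "length (h (var_of d)) = ls (var_of d)" using Cons.prems(1) by simp
  show ?case
  proof (cases "x = var_of d")
    case True
    then show ?thesis using l by (cases d) simp_all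
  next
    case False
    then have "decode p ls (concat (map (img h) p) @ s) x = h x"
      using Cons.IH Cons.prems by simp
    then show ?thesis using l False by (cases d) simp_all
  qed
qed simp

text \<open>Windows start at every position, so a short factor is always a prefix of one.\<close>

definition prefix_in :: "(nat \<times> 'a list) list \<Rightarrow> 'a list \<Rightarrow> bool" where
  "prefix_in W u \<longleftrightarrow> (\<exists>(n, v)\<in>set W. take (length u) v = u)"

text \<open>The search runs over windows, not substitutions: a window starting with the image of
  \<open>p\<close> and the lengths \<open>ls\<close> fix all images. \<open>decode\<close> reads a
  repeated variable at its first place; the prefix test checks its other places.\<close>

definition small_occ ::
    "(nat \<times> 'a list) list \<Rightarrow> 'v letter list \<Rightarrow> 'v letter list list \<Rightarrow> ('v \<Rightarrow> nat) \<Rightarrow> bool" where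
  "small_occ W p ps ls \<longleftrightarrow> (\<exists>(n, v)\<in>set W. let h = decode p ls v in
     (let u = concat (map (img h) p) in take (length u) v = u) \<and>
     (\<forall>p'\<in>set ps. prefix_in W (concat (map (img h) p'))))"

context pf_shape
begin

lemma factor_prefix_in:
  assumes "factor D u" "length u \<le> l" "l + q \<le> q * M + 1"
  shows "prefix_in (windows A B e q M l) u"
proof -
  obtain i where "occ_at D i u" using assms(1) unfolding factor_def by blast
  then have "map D [i..<i + length u] = u" unfolding occ_at_eq .
  then have "take (length u) (map D [i..<i + l]) = u" using assms(2) by (simp add: take_map)
  then show ?thesis using windows[OF assms(3), of i] unfolding prefix_in_def by blast
qed

lemma small_occ:
  assumes f: "\<forall>p'\<in>set (p # ps). factor D (concat (map (img h) p')) \<and> length (concat (map (img h) p')) \<le> l"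
    and ls: "\<forall>c\<in>set p. length (h (var_of c)) = ls (var_of c)"
    and vars: "\<forall>p'\<in>set ps. var_of ` set p' \<subseteq> var_of ` set p"
    and l: "l + q \<le> q * M + 1"
  shows "small_occ (windows A B e q M l) p ps ls"
proof -
  let ?W = "windows A B e q M l" and ?u = "concat (map (img h) p)"
  have "prefix_in ?W ?u" using factor_prefix_in[OF _ _ l] f by simp
  then obtain n v where v: "(n, v) \<in> set ?W" "take (length ?u) v = ?u"
    unfolding prefix_in_def by blast
  have dec: "decode p ls v x = h x" if "x \<in> var_of ` set p" for x
  proof -
    have "decode p ls (?u @ drop (length ?u) v) x = h x" using decode[OF ls that] .
    then show ?thesis using v(2) by (metis append_take_drop_id)
  qed
  have im: "concat (map (img (decode p ls v)) p') = concat (map (img h) p')"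
    if "var_of ` set p' \<subseteq> var_of ` set p" for p'
  proof -
    have "img (decode p ls v) c = img h c" if "c \<in> set p'" for c
      using dec[of "var_of c"] that \<open>var_of ` set p' \<subseteq> _\<close> by (cases c) auto
    then show ?thesis by (simp cong: map_cong)
  qed
  have "\<forall>p'\<in>set ps. prefix_in ?W (concat (map (img (decode p ls v)) p'))"
    using factor_prefix_in[OF _ _ l] f vars im by simp
  moreover have "let u = concat (map (img (decode p ls v)) p) in take (length u) v = u"
    using v(2) im[of p] by simp
  ultimately show ?thesis unfolding small_occ_def Let_def using v(1)
    by (intro bexI[of _ "(n, v)"]) simp_all
qed

text \<open>Prefixes of reversible factors are reversible, so testing the windows of one length
  excludes all longer factors.\<close>

lemma reversible_bound:
  assumes "\<forall>(n, v)\<in>set (windows A B e q M l). \<not> prefix_in (windows A B e q M l) (rev v)"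
    and "l + q \<le> q * M + 1" and "factor D u" "factor D (rev u)"
  shows "length u < l"
proof (rule ccontr)
  assume "\<not> length u < l"
  then have l: "length (take l u) = l" by simp
  obtain i where "occ_at D i (take l u @ drop l u)" using assms(3) unfolding factor_def by auto
  then have "occ_at D i (take l u)" unfolding occ_at_append by (rule conjunct1)
  then have i: "map D [i..<i + l] = take l u" unfolding occ_at_eq l .
  obtain j where "occ_at D j (rev (drop l u) @ rev (take l u))"
    using assms(4) unfolding factor_def rev_append[symmetric] by auto
  then have "factor D (rev (take l u))" unfolding occ_at_append factor_def by blast
  then have "prefix_in (windows A B e q M l) (rev (map D [i..<i + l]))"
    unfolding i using factor_prefix_in[OF _ _ assms(2)] l by simp
  moreover obtain x where "(x, map D [i..<i + l]) \<in> set (windows A B e q M l)"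
    using windows[OF assms(2)] by blast
  ultimately show False using assms(1) by blast
qed

lemma less_bound:
  assumes "\<forall>b\<in>set A \<union> set B. \<forall>c\<in>set b. c < k"
  shows "D n < k"
proof -
  define X where "X = (if even (n div q) then A else B)"
  define b where "b = X ! (pf (n div q) mod 2 ^ e)"
  have "length X = 2 ^ e" unfolding X_def using len by simp
  then have "b \<in> set X" unfolding b_def by (intro nth_mem) simp
  then have b: "b \<in> set A \<union> set B" unfolding X_def by (simp split: if_splits)
  then have "n mod q < length b" using len(3) q by simp
  then have "b ! (n mod q) \<in> set b" by (rule nth_mem)
  then show ?thesis using assms b unfolding D_def pfword_def X_def[symmetric] b_def[symmetric] by blast
qed

end

text \<open>In the integers, \<open>algebra\<close> can combine the congruences linearly.\<close>

lemma cong_dvd_int: "[i = j] (mod n) \<longleftrightarrow> int n dvd int i - int j" for i j n :: nat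
  unfolding cong_int_iff[symmetric] cong_iff_dvd_diff ..

lemma cong_self_addD:
  fixes i d N :: nat
  assumes "[i = i + d] (mod N)"
  shows "N dvd d"
proof -
  have "[i + d = i + 0] (mod N)" using cong_sym[OF assms] by simp
  then show ?thesis unfolding cong_add_lcancel_nat cong_0_iff .
qed

lemma cong_self_add: "[i = i + d] (mod N) \<Longrightarrow> 0 < d \<Longrightarrow> d < N \<Longrightarrow> False" for i d N :: nat
  using cong_self_addD nat_dvd_not_less by blast

lemma odd_part: "0 < n \<Longrightarrow> \<exists>k m. n = 2 ^ k * m \<and> odd m" for n :: nat
proof (induction n rule: less_induct)
  case (less n)
  show ?case
  proof (cases "even n")
    case True
    then obtain n' where n': "n = 2 * n'" by blast
    then have "n' < n" "0 < n'" using less.prems by simp_all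
    then obtain k m where "n' = 2 ^ k * m" "odd m" using less.IH by blast
    then show ?thesis using n' by (intro exI[of _ "Suc k"] exI[of _ m]) simp
  next
    case False
    then show ?thesis by (intro exI[of _ 0] exI[of _ n]) simp
  qed
qed

definition lens :: "nat \<Rightarrow> nat \<Rightarrow> nat \<Rightarrow> var \<Rightarrow> nat" where
  "lens a b c x = (case x of vx \<Rightarrow> a | vy \<Rightarrow> b | vz \<Rightarrow> c)"

definition small_free ::
    "(nat \<times> 'a list) list \<Rightarrow> var pattern \<Rightarrow> var pattern list \<Rightarrow> (nat \<times> nat \<times> nat) list \<Rightarrow> bool" where
  "small_free W p ps ns \<longleftrightarrow> (\<forall>(a, b, c)\<in>set ns. \<not> small_occ W p ps (lens a b c))"

definition irreversible :: "(nat \<times> 'a list) list \<Rightarrow> bool" where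
  "irreversible W \<longleftrightarrow> (\<forall>(n, v)\<in>set W. \<not> prefix_in W (rev v))"

context pf_shape
begin

lemma small_freeD:
  assumes "small_free (windows A B e q M l) p ps ns" "(a, b, c) \<in> set ns"
    and "l + q \<le> q * M + 1"
    and "factor D (concat (map (img h) p))" "length (concat (map (img h) p)) \<le> l"
    and "\<forall>p'\<in>set ps. factor D (concat (map (img h) p')) \<and> length (concat (map (img h) p')) \<le> l"
    and "\<forall>d\<in>set p. length (h (var_of d)) = lens a b c (var_of d)"
    and "\<forall>p'\<in>set ps. var_of ` set p' \<subseteq> var_of ` set p"
  shows False
  using assms small_occ[of p ps h l "lens a b c" M] unfolding small_free_def by fastforce

end

section \<open>The words\<close>

text \<open>Up to renaming letters, \<open>wordP\<close> is the fixed point of \<open>0 \<mapsto> 01, 1 \<mapsto> 21, 2 \<mapsto> 03, 3 \<mapsto> 23\<close>. The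
  blocks of the other words were found by a computer search.\<close>

definition "PA = [[0], [1 :: nat]]"
definition "PB = [[2], [3 :: nat]]"
definition "wordP = pfword PA PB 1 1"

interpretation P: pf_word PA PB 1 1 wordP 0 1 1 1
proof unfold_locales
  show "wordP \<equiv> pfword PA PB 1 1" by (rule eq_reflection) (rule wordP_def)
  show "synced (windows PA PB 1 1 1 1) (1 * 2 ^ 1)" by code_simp
  show "differ PA 1 0 1" "differ PB 1 0 1" by code_simp+
  show "length PA = 2 ^ 1" "length PB = 2 ^ 1" "\<forall>b\<in>set PA \<union> set PB. length b = 1"
    by (simp_all add: PA_def PB_def)
qed simp_all

text \<open>Even blocks use only 0 and 1, odd blocks only 2 and 3. In a block, an equal pair starts
  at offset 0 and an unequal one at offset 1; a pair across a boundary shows which kind of block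
  comes first. So two letters fix the position modulo 6.\<close>

definition "DA = [[0, 0, 1], [1, 1, 0 :: nat]]"
definition "DB = [[2, 2, 3], [3, 3, 2 :: nat]]"
definition "wordD = pfword DA DB 1 3"

interpretation D: pf_word DA DB 1 3 wordD 0 3 2 2
proof unfold_locales
  show "wordD \<equiv> pfword DA DB 1 3" by (rule eq_reflection) (rule wordD_def)
  show "synced (windows DA DB 1 3 2 2) (3 * 2 ^ 1)" by code_simp
  show "differ DA 1 0 3" "differ DB 1 0 3" by code_simp+
  show "length DA = 2 ^ 1" "length DB = 2 ^ 1" "\<forall>b\<in>set DA \<union> set DB. length b = 3"
    by (simp_all add: DA_def DB_def)
qed simp_all

definition "CA = [[0, 0, 1], [1, 2, 0 :: nat]]"
definition "CB = [[0, 2, 1], [1, 0, 2 :: nat]]"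
definition "wordC = pfword CA CB 1 3"

interpretation C: pf_word CA CB 1 3 wordC 0 3 5 3
proof unfold_locales
  show "wordC \<equiv> pfword CA CB 1 3" by (rule eq_reflection) (rule wordC_def)
  show "synced (windows CA CB 1 3 3 5) (3 * 2 ^ 1)" by code_simp
  show "differ CA 1 0 3" "differ CB 1 0 3" by code_simp+
  show "length CA = 2 ^ 1" "length CB = 2 ^ 1" "\<forall>b\<in>set CA \<union> set CB. length b = 3"
    by (simp_all add: CA_def CB_def)
qed simp_all

text \<open>The blocks differ at offsets 2 and 3 only, whence \<open>r0 = w = 2\<close>. This is
  enough for squares, where the modulus has to exceed just the length of the repeated word.\<close>

definition "SA = [[0, 1, 0, 2, 0, 1, 2, 0, 2], [0, 1, 2, 1, 0, 1, 2, 0, 2 :: nat]]"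
definition "SB = [[1, 0, 1, 2, 1, 0, 2, 1, 2], [1, 0, 2, 0, 1, 0, 2, 1, 2 :: nat]]"
definition "wordS = pfword SA SB 1 9"

interpretation S: pf_word SA SB 1 9 wordS 2 2 6 2
proof unfold_locales
  show "wordS \<equiv> pfword SA SB 1 9" by (rule eq_reflection) (rule wordS_def)
  show "synced (windows SA SB 1 9 2 6) (9 * 2 ^ 1)" by code_simp
  show "differ SA 1 2 2" "differ SB 1 2 2" by code_simp+
  show "length SA = 2 ^ 1" "length SB = 2 ^ 1" "\<forall>b\<in>set SA \<union> set SB. length b = 9"
    by (simp_all add: SA_def SB_def)
qed simp_all

definition "EA = [[0, 0], [1, 2], [2, 1], [3, 3 :: nat]]"
definition "EB = [[0, 1], [0, 1], [2, 3], [2, 3 :: nat]]"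
definition "wordE = pfword EA EB 2 2"

interpretation E: pf_word EA EB 2 2 wordE 0 2 3 2
proof unfold_locales
  show "wordE \<equiv> pfword EA EB 2 2" by (rule eq_reflection) (rule wordE_def)
  show "synced (windows EA EB 2 2 2 3) (2 * 2 ^ 2)" by code_simp
  show "differ EA 2 0 2" "differ EB 2 0 2" by code_simp+
  show "length EA = 2 ^ 2" "length EB = 2 ^ 2" "\<forall>b\<in>set EA \<union> set EB. length b = 2"
    by (simp_all add: EA_def EB_def)
qed simp_all

text \<open>The two blocks of each list differ at all 7 offsets, so the surplus 7 exceeds the total
  length 3 + 3 of two reversible images.\<close>

definition "FA = [[0, 0, 1, 1, 2, 2, 3], [1, 1, 2, 2, 4, 4, 4 :: nat]]"
definition "FB = [[0, 1, 2, 4, 3, 3, 0], [3, 3, 0, 1, 2, 4, 3 :: nat]]"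
definition "wordF = pfword FA FB 1 7"

interpretation F: pf_word FA FB 1 7 wordF 0 7 7 2
proof unfold_locales
  show "wordF \<equiv> pfword FA FB 1 7" by (rule eq_reflection) (rule wordF_def)
  show "synced (windows FA FB 1 7 2 7) (7 * 2 ^ 1)" by code_simp
  show "differ FA 1 0 7" "differ FB 1 0 7" by code_simp+
  show "length FA = 2 ^ 1" "length FB = 2 ^ 1" "\<forall>b\<in>set FA \<union> set FB. length b = 7"
    by (simp_all add: FA_def FB_def)
qed simp_all

text \<open>Reversible factors of \<open>wordF\<close> are constant. So for the images of
  \<open>y\<close> and \<open>z\<close> in \<open>xyzx\<close> only agreement with their own shift
  by one is tested, without any search for reversed words.\<close>

definition power_free :: "(nat \<times> 'a list) list \<Rightarrow> (nat \<times> nat \<times> nat) list \<Rightarrow> bool" where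
  "power_free W ns \<longleftrightarrow> (\<forall>(n, v)\<in>set W. \<forall>(a, b, c)\<in>set ns.
     \<not> (take a v = take a (drop (a + b + c) v) \<and>
        take (b - 1) (drop a v) = take (b - 1) (drop (a + 1) v) \<and>
        take (c - 1) (drop (a + b) v) = take (c - 1) (drop (a + b + 1) v)))"

text \<open>All pairs with \<open>a + b < 5\<close>; the third length belongs to the absent variable
  \<open>vz\<close>.\<close>

lemma C_small:
  "small_free (windows CA CB 1 3 4 7) [X,Y,X] [[Y,X,Y]]
    [(1,1,1), (1,2,1), (1,3,1), (2,1,1), (2,2,1), (3,1,1)]"
  by code_simp

text \<open>\<open>S.modulus\<close> requires \<open>9 < a + 2\<close>, which leaves
  \<open>a \<le> 7\<close>.\<close>

lemma S_small:
  "\<forall>(n, v)\<in>set (windows SA SB 1 9 3 14). \<forall>a\<in>set [1,2,3,4,5,6,7]. take a v \<noteq> take a (drop a v)"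
  by code_simp

lemma E_small:
  "small_free (windows EA EB 2 2 5 8) [X,Y,Z,X] [[Y,Z,X,Y], [Z,Y,Z]]
    [(1,1,1), (1,1,2), (1,2,1), (1,2,2), (2,1,1), (2,1,2), (2,2,1), (2,2,2)]"
  by code_simp

lemma D_irreversible: "irreversible (windows DA DB 1 3 2 3)"
  by code_simp

lemma D_small_xyx: "small_free (windows DA DB 1 3 2 4) [X,Y,X] [[YR]] [(1,1,1), (1,2,1)]"
  by code_simp

lemma D_small_xyzyx:
  "list_all (\<lambda>(p, p'). small_free (windows DA DB 1 3 3 7) p [p'] [(1,1,1), (1,2,1)])
    [([X,Y,Z,Y,X], [Z,Y,X,YR,Z]), ([X,Y,Z,Y,X], [Z,YR,X,Y,Z]), ([X,Y,Z,Y,X], [Z,YR,X,YR,Z]),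
     ([X,Y,Z,YR,X], [Z,Y,X,YR,Z]), ([X,Y,Z,YR,X], [Z,YR,X,Y,Z])]"
  by code_simp

lemma D_small_xyzx:
  "small_free (windows DA DB 1 3 3 5) [X,Y,Z,X] [[Y,Z,X,Y], [ZR]] [(1,1,1), (1,1,2)]"
  "small_free (windows DA DB 1 3 3 5) [X,Y,Z,X] [[Y,ZR,X,Y]] [(1,1,1), (1,1,2)]"
  by code_simp+

lemma F_irreversible: "irreversible (windows FA FB 1 7 2 4)"
  by code_simp

lemma F_reversible_pairs:
  "\<forall>(n, v)\<in>set (windows FA FB 1 7 2 2). v = rev v \<or> \<not> prefix_in (windows FA FB 1 7 2 2) (rev v)"
  by code_simp

lemma F_power_free:
  "power_free (windows FA FB 1 7 4 18) (List.product [1,2,3,4,5,6] (List.product [1,2,3] [1,2,3]))"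
  by code_simp

section \<open>Avoidable formulas\<close>

lemma P_cong:
  assumes "occ_at wordP i u" "occ_at wordP j u" "u \<noteq> []" "2 ^ k dvd length u"
  shows "int (2 ^ Suc k) dvd int i - int j"
proof -
  have "2 ^ k \<le> length u" using assms(3,4) by (simp add: dvd_imp_le)
  moreover have "1 \<le> length u" using assms(3) by (simp add: Suc_le_eq)
  ultimately have "[i = j] (mod 1 * 2 ^ (k + 1))"
    by (intro P.agree_cong[of i j "length u" k] agree_occ_at assms(1,2)) simp_all
  then show ?thesis unfolding cong_dvd_int by simp
qed

text \<open>If \<open>2 ^ k\<close> divides all three lengths, then \<open>P_cong\<close> fixes all
  positions modulo \<open>2 ^ Suc k\<close>, and the fragments make the lengths divisible by that
  too. By induction every power of two divides them.\<close>

lemma avoidable_xy_xz_yx_zx_zy: "avoidable 4 {|[X,Y], [X,Z], [Y,X], [Z,X], [Z,Y]|}"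
proof (rule avoidableI[of wordP])
  show "wordP n < 4" for n by (rule P.less_bound) (simp add: PA_def PB_def)
next
  fix h :: "var \<Rightarrow> nat list"
  assume ne: "\<And>x. h x \<noteq> []"
    and f: "\<And>p. p |\<in>| {|[X,Y], [X,Z], [Y,X], [Z,X], [Z,Y]|} \<Longrightarrow> factor wordP (concat (map (img h) p))"
  define a b c where "a = length (h vx)" and "b = length (h vy)" and "c = length (h vz)"
  obtain i1 where 1: "occ_at wordP i1 (h vx)" "occ_at wordP (i1 + a) (h vy)"
    using f[of "[X,Y]"] by (auto simp: factor_def occ_at_append a_def)
  obtain i2 where 2: "occ_at wordP i2 (h vx)" "occ_at wordP (i2 + a) (h vz)"
    using f[of "[X,Z]"] by (auto simp: factor_def occ_at_append a_def)
  obtain i3 where 3: "occ_at wordP i3 (h vy)" "occ_at wordP (i3 + b) (h vx)"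
    using f[of "[Y,X]"] by (auto simp: factor_def occ_at_append b_def)
  obtain i4 where 4: "occ_at wordP i4 (h vz)" "occ_at wordP (i4 + c) (h vx)"
    using f[of "[Z,X]"] by (auto simp: factor_def occ_at_append c_def)
  obtain i5 where 5: "occ_at wordP i5 (h vz)" "occ_at wordP (i5 + c) (h vy)"
    using f[of "[Z,Y]"] by (auto simp: factor_def occ_at_append c_def)
  have "2 ^ k dvd a \<and> 2 ^ k dvd b \<and> 2 ^ k dvd c" for k
  proof (induction k)
    case 0
    show ?case by simp
  next
    case (Suc k)
    let ?n = "int (2 ^ Suc k)"
    have x: "?n dvd int i - int j" if "occ_at wordP i (h vx)" "occ_at wordP j (h vx)" for i j
      using P_cong[OF that ne] Suc a_def by simp
    have y: "?n dvd int i - int j" if "occ_at wordP i (h vy)" "occ_at wordP j (h vy)" for i j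
      using P_cong[OF that ne] Suc b_def by simp
    have z: "?n dvd int i - int j" if "occ_at wordP i (h vz)" "occ_at wordP j (h vz)" for i j
      using P_cong[OF that ne] Suc c_def by simp
    note d = x[OF 1(1) 2(1)] x[OF 1(1) 3(2)] x[OF 1(1) 4(2)] y[OF 1(2) 3(1)] y[OF 3(1) 5(2)]
      z[OF 2(2) 4(1)] z[OF 4(1) 5(1)]
    \<comment> \<open>Modulo \<open>n\<close>, \<open>zx\<close> and \<open>zy\<close> place
      \<open>x\<close> and \<open>y\<close> equally, and \<open>xy\<close> and \<open>xz\<close>
      place \<open>y\<close> and \<open>z\<close> equally. All three residues coincide, so the
      lengths vanish.\<close>
    have *: "n dvd i1 - i2 \<Longrightarrow> n dvd i1 - (i3 + b) \<Longrightarrow> n dvd i1 - (i4 + c) \<Longrightarrow> n dvd i1 + a - i3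
      \<Longrightarrow> n dvd i3 - (i5 + c) \<Longrightarrow> n dvd i2 + a - i4 \<Longrightarrow> n dvd i4 - i5
      \<Longrightarrow> n dvd a \<and> n dvd b \<and> n dvd c" for n i1 i2 i3 b i4 c a i5 :: int
      by (intro conjI) algebra+
    have "?n dvd int a \<and> ?n dvd int b \<and> ?n dvd int c"
      by (rule *[of _ "int i1" "int i2" "int i3" "int b" "int i4" "int c" "int a" "int i5"])
        (use d in \<open>simp_all del: power_Suc\<close>)
    then show ?case unfolding int_dvd_int_iff .
  qed
  then have "2 ^ a dvd a" by blast
  moreover have "0 < a" unfolding a_def using ne by simp
  ultimately have "2 ^ a \<le> a" by (rule dvd_imp_le)
  then show False using less_exp[of a] by simp
qed

text \<open>Each rotation of \<open>xyz\<close> occurs in two fragments. The three displacements add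
  up to \<open>a + b + c\<close>, which is less than the modulus.\<close>

lemma avoidable_xyzx_yzxy_zxyz: "avoidable 4 {|[X,Y,Z,X], [Y,Z,X,Y], [Z,X,Y,Z]|}"
proof (rule avoidableI[of wordP])
  show "wordP n < 4" for n by (rule P.less_bound) (simp add: PA_def PB_def)
next
  fix h :: "var \<Rightarrow> nat list"
  assume ne: "\<And>x. h x \<noteq> []"
    and f: "\<And>p. p |\<in>| {|[X,Y,Z,X], [Y,Z,X,Y], [Z,X,Y,Z]|} \<Longrightarrow> factor wordP (concat (map (img h) p))"
  define a b c where "a = length (h vx)" and "b = length (h vy)" and "c = length (h vz)"
  note l = a_def[symmetric] b_def[symmetric] c_def[symmetric]
  have pos: "0 < a" "0 < b" "0 < c" using ne unfolding a_def b_def c_def by simp_all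
  obtain i where 1: "occ_at wordP i (h vx @ h vy @ h vz @ h vx)"
    using f[of "[X,Y,Z,X]"] by (auto simp: factor_def)
  obtain j where 2: "occ_at wordP j (h vy @ h vz @ h vx @ h vy)"
    using f[of "[Y,Z,X,Y]"] by (auto simp: factor_def)
  obtain k where 3: "occ_at wordP k (h vz @ h vx @ h vy @ h vz)"
    using f[of "[Z,X,Y,Z]"] by (auto simp: factor_def)
  let ?p = "a + b + c"
  have "agree wordP (i + a) j (length (h vy @ h vz @ h vx))"
    by (rule agree_occ_at) (use 1 2 in \<open>simp_all add: occ_at_append l\<close>)
  moreover have "agree wordP (j + b) k (length (h vz @ h vx @ h vy))"
    by (rule agree_occ_at) (use 2 3 in \<open>simp_all add: occ_at_append l\<close>)
  moreover have "agree wordP (k + c) i (length (h vx @ h vy @ h vz))"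
    by (rule agree_occ_at) (use 3 1 in \<open>simp_all add: occ_at_append l\<close>)
  ultimately have ag: "agree wordP (i + a) j ?p" "agree wordP (j + b) k ?p" "agree wordP (k + c) i ?p"
    by (simp_all add: l ac_simps)
  obtain N where "2 ^ (1 - 1) * (?p + 1) \<le> N"
      and N: "\<And>i j. agree wordP i j ?p \<Longrightarrow> [i = j] (mod N)"
    by (rule P.modulus[of ?p]) (use pos in simp_all)
  then have "?p < N" by simp
  have *: "n dvd i + a - j \<Longrightarrow> n dvd j + b - k \<Longrightarrow> n dvd k + c - i \<Longrightarrow> n dvd a + b + c"
    for n i j k a b c :: int by algebra
  have "int N dvd int a + int b + int c"
    by (rule *) (use ag[THEN N] in \<open>simp_all add: cong_dvd_int\<close>)
  then have "int N dvd int ?p" by simp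
  then have "N dvd ?p" unfolding int_dvd_int_iff .
  then show False using \<open>?p < N\<close> pos by (simp add: nat_dvd_not_less)
qed

text \<open>Both rotations \<open>xy\<close> and \<open>yx\<close> occur in both fragments; the
  displacements add up to \<open>a + b\<close>, below the modulus once
  \<open>a + b \<ge> 5\<close>.\<close>

lemma avoidable_xyx_yxy: "avoidable 3 {|[X,Y,X], [Y,X,Y]|}"
proof (rule avoidableI[of wordC])
  show "wordC n < 3" for n by (rule C.less_bound) (simp add: CA_def CB_def)
next
  fix h :: "var \<Rightarrow> nat list"
  assume ne: "\<And>x. h x \<noteq> []"
    and f: "\<And>p. p |\<in>| {|[X,Y,X], [Y,X,Y]|} \<Longrightarrow> factor wordC (concat (map (img h) p))"
  define a b where "a = length (h vx)" and "b = length (h vy)"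
  note l = a_def[symmetric] b_def[symmetric]
  have pos: "0 < a" "0 < b" using ne unfolding a_def b_def by simp_all
  have fx: "factor wordC (concat (map (img h) [X,Y,X]))" "factor wordC (concat (map (img h) [Y,X,Y]))"
    by (rule f, simp)+
  show False
  proof (cases "a + b < 5")
    case True
    then have "a = 1 \<or> a = 2 \<or> a = 3" "b = 1 \<or> b = 2 \<or> b = 3" using pos by linarith+
    then have "a = 1 \<and> b = 1 \<or> a = 1 \<and> b = 2 \<or> a = 1 \<and> b = 3 \<or> a = 2 \<and> b = 1 \<or>
        a = 2 \<and> b = 2 \<or> a = 3 \<and> b = 1"
      using True by (elim disjE) simp_all
    then have mem: "(a, b, 1) \<in> set [(1,1,1), (1,2,1), (1,3,1), (2,1,1), (2,2,1), (3,1,1)]"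
      by (simp only: list.set insert_iff prod.inject) blast
    have "a + (b + a) \<le> 7" "b + (a + b) \<le> 7" using True pos by linarith+
    then show False
      by (intro C.small_freeD[OF C_small mem _ fx(1)]) (use fx(2) in \<open>simp_all add: l lens_def\<close>)
  next
    case False
    obtain i where 1: "occ_at wordC i (h vx @ h vy @ h vx)"
      using fx(1) by (auto simp: factor_def)
    obtain j where 2: "occ_at wordC j (h vy @ h vx @ h vy)"
      using fx(2) by (auto simp: factor_def)
    have "agree wordC (i + a) j (length (h vy @ h vx))"
      by (rule agree_occ_at) (use 1 2 in \<open>simp_all add: occ_at_append l\<close>)
    moreover have "agree wordC (j + b) i (length (h vx @ h vy))"
      by (rule agree_occ_at) (use 2 1 in \<open>simp_all add: occ_at_append l\<close>)
    ultimately have ag: "agree wordC (i + a) j (a + b)" "agree wordC (j + b) i (a + b)"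
      by (simp_all add: l ac_simps)
    obtain N where "2 ^ (1 - 1) * (a + b + 3) \<le> N"
        and N: "\<And>i j. agree wordC i j (a + b) \<Longrightarrow> [i = j] (mod N)"
      by (rule C.modulus[of "a + b"]) (use False pos in simp_all)
    then have "a + b < N" by simp
    have *: "n dvd i + a - j \<Longrightarrow> n dvd j + b - i \<Longrightarrow> n dvd a + b" for n i j a b :: int by algebra
    have "int N dvd int a + int b"
      by (rule *) (use ag[THEN N] in \<open>simp_all add: cong_dvd_int\<close>)
    then have "int N dvd int (a + b)" by simp
    then have "N dvd a + b" unfolding int_dvd_int_iff .
    then show False using \<open>a + b < N\<close> pos by (simp add: nat_dvd_not_less)
  qed
qed

lemma avoidable_xx: "avoidable 3 {|[X,X]|}"
proof (rule avoidableI[of wordS])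
  show "wordS n < 3" for n by (rule S.less_bound) (simp add: SA_def SB_def)
next
  fix h :: "var \<Rightarrow> nat list"
  assume ne: "\<And>x. h x \<noteq> []"
    and f: "\<And>p. p |\<in>| {|[X,X]|} \<Longrightarrow> factor wordS (concat (map (img h) p))"
  define a where "a = length (h vx)"
  have pos: "0 < a" using ne unfolding a_def by simp
  have fx: "factor wordS (concat (map (img h) [X,X]))" using f by simp
  show False
  proof (cases "a < 8")
    case True
    have "prefix_in (windows SA SB 1 9 3 14) (h vx @ h vx)"
      using S.factor_prefix_in[OF fx, of 14 3] True by (simp add: a_def)
    then obtain n v where "(n, v) \<in> set (windows SA SB 1 9 3 14)" "take (a + a) v = h vx @ h vx"
      unfolding prefix_in_def a_def by auto
    moreover from this(2) have "v = (h vx @ h vx) @ drop (a + a) v" by (metis append_take_drop_id)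
    then obtain r where "v = h vx @ h vx @ r" by simp
    then have "take a v = h vx" "take a (drop a v) = h vx" by (simp_all add: a_def)
    moreover have "a \<in> set [1,2,3,4,5,6,7]" using pos True by auto
    moreover have "\<forall>a\<in>set [1,2,3,4,5,6,7]. take a v \<noteq> take a (drop a v)"
      using bspec[OF S_small \<open>(n, v) \<in> _\<close>] by (simp only: prod.case)
    ultimately show False by metis
  next
    case False
    obtain i where "occ_at wordS i (h vx @ h vx)" using fx by (auto simp: factor_def)
    then have ag: "agree wordS i (i + a) a"
      using agree_occ_at[of wordS i "h vx" "i + a"] by (simp add: occ_at_append a_def)
    obtain N where "2 ^ (1 - 1) * (a + 2) \<le> N"
        and "\<And>i j. agree wordS i j a \<Longrightarrow> [i = j] (mod N)"
      by (rule S.modulus[of a]) (use False in simp_all)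
    then show False using cong_self_add[of i a N] ag pos by simp
  qed
qed

section \<open>Formulas avoided by \<open>wordD\<close>\<close>

lemma factor_appendD: "factor D (u @ v) \<Longrightarrow> factor D u \<and> factor D v"
  unfolding factor_def occ_at_append by blast

lemma D_reversible: "factor wordD u \<Longrightarrow> factor wordD (rev u) \<Longrightarrow> length u \<le> 2"
  using D.reversible_bound[of 2 3 u] D_irreversible unfolding irreversible_def by simp

text \<open>Going around the period \<open>p\<close>, the occurrences of the two repeated words leave gaps of
  length at most \<open>2\<close>, which are too short to contain a block on which \<open>wordD\<close> differs from its
  shift by \<open>p\<close>.\<close>

lemma D_gap:
  assumes gap: "b1 \<le> 2" "b2 \<le> 2" and pos: "0 < a" "0 < c" and p: "p = a + b1 + c + b2"
    and x: "agree wordD i (i + p) a" and z: "agree wordD j (j + p) c"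
    and xx: "agree wordD i (j + c + b2) a" and zz: "agree wordD (i + a + b1) j c"
  shows "a = 1 \<and> c = 1"
proof (rule ccontr)
  assume "\<not> (a = 1 \<and> c = 1)"
  \<comment> \<open>For \<open>wordD\<close>, \<open>L = 2\<close>: a repeated word of two letters
    already fixes the distance modulo 6.\<close>
  then have two: "2 \<le> a \<or> 2 \<le> c" using pos by linarith
  have "3 * 2 ^ 1 dvd p"
    using two cong_self_addD[OF D.agree_base[OF x]] cong_self_addD[OF D.agree_base[OF z]] by blast
  then have "6 dvd p" by simp
  then obtain p' where p': "p = 6 * p'" by blast
  have "0 < p'" using p' p pos by simp
  then obtain k m where "p' = 2 ^ k * m" and m: "odd m" using odd_part by blast
  then have pk: "p = 3 * 2 ^ (k + 1) * m" using p' by simp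
  let ?N = "3 * 2 ^ Suc k :: nat"
  have a: "\<not> D.hit k (i + s)" if "s < a" for s
    using D.agree_period(1)[of i k m a s] x[unfolded pk] m that by blast
  have c: "\<not> D.hit k (j + s)" if "s < c" for s
    using D.agree_period(1)[of j k m c s] z[unfolded pk] m that by blast
  have la: "a + 3 \<le> ?N" using D.agree_period(2)[of i k m a] x[unfolded pk] m by blast
  have lc: "c + 3 \<le> ?N" using D.agree_period(2)[of j k m c] z[unfolded pk] m by blast
  \<comment> \<open>\<open>a + 3\<close> and \<open>c + 3\<close> are at most \<open>?N\<close> and
    the gaps contribute at most 4, so \<open>p < 2 * ?N\<close>.\<close>
  have "m < 2"
  proof (rule ccontr)
    assume "\<not> m < 2"
    then have "?N * 2 \<le> ?N * m" by (intro mult_le_mono) auto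
    then have "?N * 2 \<le> p" unfolding pk by simp
    then show False using la lc gap p by linarith
  qed
  then have "m = 1" using m by (cases "m = 0") auto
  then have pN: "p = ?N" using pk by simp
  \<comment> \<open>The longer of the two repeated words has more than \<open>3 * 2 ^ k - 3\<close>
    letters and so fixes positions modulo the whole period. Hence the word repeated at
    \<open>j\<close> may be placed between the copies of the one at \<open>i\<close>.\<close>
  have ji: "[i + a + b1 = j] (mod ?N)"
  proof (cases "c \<le> a")
    case True
    have "3 * 2 ^ k < a + 3" using True p pN gap by simp
    then have "[i = j + c + b2] (mod 3 * 2 ^ (k + 1))"
      using D.agree_cong[OF xx, of k] two by (cases "2 \<le> a") (use True in auto)
    then have "[i + a + b1 = j + p] (mod ?N)"
      using cong_add_rcancel_nat[of i "a + b1" "j + c + b2" ?N] p by (simp add: ac_simps)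
    then show ?thesis unfolding pN by (simp add: cong_def)
  next
    case False
    have "3 * 2 ^ k < c + 3" using False p pN gap by simp
    then show ?thesis using D.agree_cong[OF zz, of k] two False by (cases "2 \<le> c") auto
  qed
  have zhit: "\<not> D.hit k (i + a + b1 + s)" if "s < c" for s
  proof -
    have "[i + a + b1 + s = j + s] (mod ?N)" using ji by (simp add: cong_add_rcancel_nat)
    then show ?thesis using D.hit_cong c[OF that] by blast
  qed
  \<comment> \<open>Three hits in a row cannot fit into a gap of two letters, so the run meets one
    of the repeated words or wraps around to \<open>i\<close>.\<close>
  obtain s where s: "s < ?N" "\<And>t. t < 3 \<Longrightarrow> D.hit k (i + s + t)" using D.hit_run by blast
  consider "s < a" | "a \<le> s" "s < a + b1" | "a + b1 \<le> s" "s < a + b1 + c" | "a + b1 + c \<le> s" by linarith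
  then show False
  proof cases
    case 1
    then show False using a s(2)[of 0] by simp
  next
    case 2
    then have "a + b1 - s < 3" using gap by linarith
    then have "D.hit k (i + s + (a + b1 - s))" by (rule s(2))
    then show False using zhit[of 0] pos 2 by (simp add: add.assoc)
  next
    case 3
    then show False using zhit[of "s - (a + b1)"] s(2)[of 0] by simp
  next
    case 4
    have "?N - s < 3" using 4 p pN gap by linarith
    then have "D.hit k (i + s + (?N - s))" by (rule s(2))
    moreover have "i + s + (?N - s) = i + ?N" using s(1) by simp
    ultimately have "D.hit k (i + ?N)" by (simp only:)
    moreover have "[i + ?N = i] (mod ?N)" by (simp add: cong_def)
    ultimately have "D.hit k i" using D.hit_cong by blast
    then show False using a[of 0] pos by simp
  qed
qed

text \<open>Being reversible, \<open>y\<close> has at most 2 letters, so \<open>x\<close> is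
  repeated at distance at most \<open>a + 2\<close>, while the modulus is at least
  \<open>a + 3\<close>.\<close>

lemma avoidable_xyx_rev: "avoidable 4 {|[X,Y,X], [YR]|}"
proof (rule avoidableI[of wordD])
  show "wordD n < 4" for n by (rule D.less_bound) (simp add: DA_def DB_def)
next
  fix h :: "var \<Rightarrow> nat list"
  assume ne: "\<And>x. h x \<noteq> []"
    and f: "\<And>p. p |\<in>| {|[X,Y,X], [YR]|} \<Longrightarrow> factor wordD (concat (map (img h) p))"
  define a b where "a = length (h vx)" and "b = length (h vy)"
  note l = a_def[symmetric] b_def[symmetric]
  have pos: "0 < a" "0 < b" using ne unfolding a_def b_def by simp_all
  have fx: "factor wordD (concat (map (img h) [X,Y,X]))" "factor wordD (concat (map (img h) [YR]))"
    by (rule f, simp)+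
  obtain i where i: "occ_at wordD i (h vx @ h vy @ h vx)" using fx(1) by (auto simp: factor_def)
  have "factor wordD (h vy)" using i unfolding occ_at_append factor_def by blast
  then have b: "b \<le> 2" using D_reversible[of "h vy"] fx(2) by (simp add: b_def)
  show False
  proof (cases "a = 1")
    case True
    then have "(a, b, 1) \<in> set [(1,1,1), (1,2,1)]" using pos b by auto
    then show False
      by (rule D.small_freeD[OF D_small_xyx, where h = h]) (use fx pos b True in \<open>simp_all add: l lens_def\<close>)
  next
    case False
    have ag: "agree wordD i (i + (a + b)) a"
      using agree_occ_at[of wordD i "h vx" "i + (a + b)"] i
      by (simp add: occ_at_append l ac_simps)
    obtain N where "2 ^ (1 - 1) * (a + 3) \<le> N"
        and "\<And>i j. agree wordD i j a \<Longrightarrow> [i = j] (mod N)"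
      by (rule D.modulus[of a]) (use False pos in simp_all)
    then show False using cong_self_add[of i "a + b" N] ag pos b by simp
  qed
qed

text \<open>\<open>ys\<close> says that both orientations of \<open>y\<close> occur, which bounds
  its image by 2 letters; beyond the finite search only its length matters.\<close>

lemma avoidable_xyzyx_zyxyz_rev:
  assumes ys: "{y1, y2, y3, y4} = {Y, YR}"
    and small: "small_free (windows DA DB 1 3 3 7) [X,y1,Z,y2,X] [[Z,y3,X,y4,Z]] [(1,1,1), (1,2,1)]"
  shows "avoidable 4 {|[X,y1,Z,y2,X], [Z,y3,X,y4,Z]|}"
proof (rule avoidableI[of wordD])
  show "wordD n < 4" for n by (rule D.less_bound) (simp add: DA_def DB_def)
next
  fix h :: "var \<Rightarrow> nat list"
  assume ne: "\<And>x. h x \<noteq> []"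
    and f: "\<And>p. p |\<in>| {|[X,y1,Z,y2,X], [Z,y3,X,y4,Z]|} \<Longrightarrow> factor wordD (concat (map (img h) p))"
  define a b c where "a = length (h vx)" and "b = length (h vy)" and "c = length (h vz)"
  note l = a_def[symmetric] b_def[symmetric] c_def[symmetric]
  have pos: "0 < a" "0 < b" "0 < c" using ne unfolding a_def b_def c_def by simp_all
  have fx: "factor wordD (concat (map (img h) [X,y1,Z,y2,X]))"
      "factor wordD (concat (map (img h) [Z,y3,X,y4,Z]))"
    by (rule f, simp)+
  have yb: "y1 \<in> {Y, YR}" "y2 \<in> {Y, YR}" "y3 \<in> {Y, YR}" "y4 \<in> {Y, YR}" using ys by blast+
  then have lb: "length (img h y1) = b" "length (img h y2) = b" "length (img h y3) = b" "length (img h y4) = b"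
    unfolding b_def by auto
  obtain i where i: "occ_at wordD i (h vx @ img h y1 @ h vz @ img h y2 @ h vx)"
    using fx(1) by (auto simp: factor_def)
  obtain j where j: "occ_at wordD j (h vz @ img h y3 @ h vx @ img h y4 @ h vz)"
    using fx(2) by (auto simp: factor_def)
  have "factor wordD (img h y)" if "y \<in> {y1, y2, y3, y4}" for y
    using i j that unfolding occ_at_append factor_def by blast
  from this[of Y] this[of YR] have b: "b \<le> 2"
    unfolding ys using D_reversible[of "h vy"] by (simp add: b_def)
  have "a = 1 \<and> c = 1"
  proof (rule D_gap[of b b a c "a + b + c + b" i j])
    show "agree wordD i (i + (a + b + c + b)) a"
      using agree_occ_at[of wordD i "h vx" "i + (a + b + c + b)"] i
      by (simp add: occ_at_append l lb ac_simps)
    show "agree wordD j (j + (a + b + c + b)) c"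
      using agree_occ_at[of wordD j "h vz" "j + (a + b + c + b)"] j
      by (simp add: occ_at_append l lb ac_simps)
    show "agree wordD i (j + c + b) a"
      using agree_occ_at[of wordD i "h vx" "j + c + b"] i j
      by (simp add: occ_at_append l lb ac_simps)
    show "agree wordD (i + a + b) j c"
      using agree_occ_at[of wordD "i + a + b" "h vz" j] i j
      by (simp add: occ_at_append l lb ac_simps)
  qed (use b pos in simp_all)
  moreover from this have "(a, b, c) \<in> set [(1,1,1), (1,2,1)]" using pos b by auto
  then show False
    by (rule D.small_freeD[OF small, where h = h])
      (use fx pos b yb calculation in \<open>auto simp: l lb lens_def\<close>)
qed

text \<open>In the period of \<open>xyzx\<close> the words \<open>x\<close> and \<open>y\<close> are
  adjacent, so \<open>D_gap\<close> applies with gaps 0 and \<open>length z\<close>. Only the length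
  of \<open>z'\<close> matters, so it may be the reversed word.\<close>

lemma D_xyzx_yzxy:
  assumes i: "occ_at wordD i (x @ y @ z @ x)" and j: "occ_at wordD j (y @ z' @ x @ y)"
    and ne: "x \<noteq> []" "y \<noteq> []" and z: "length z \<le> 2" "length z' = length z"
  shows "length x = 1 \<and> length y = 1"
proof -
  define a b c where "a = length x" and "b = length y" and "c = length z"
  note l = a_def[symmetric] b_def[symmetric] c_def[symmetric]
  have "a = 1 \<and> b = 1"
  proof (rule D_gap[of 0 c a b "a + 0 + b + c" i j])
    show "agree wordD i (i + (a + 0 + b + c)) a"
      using agree_occ_at[of wordD i x "i + (a + b + c)"] i
      by (simp add: occ_at_append l ac_simps)
    show "agree wordD j (j + (a + 0 + b + c)) b"
      using agree_occ_at[of wordD j y "j + (a + b + c)"] j z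
      by (simp add: occ_at_append l ac_simps)
    show "agree wordD i (j + b + c) a"
      using agree_occ_at[of wordD i x "j + b + c"] i j z
      by (simp add: occ_at_append l ac_simps)
    show "agree wordD (i + a + 0) j b"
      using agree_occ_at[of wordD "i + a" y j] i j
      by (simp add: occ_at_append l ac_simps)
  qed (use ne z in \<open>simp_all add: a_def b_def c_def\<close>)
  then show ?thesis unfolding a_def b_def .
qed

lemma avoidable_xyzx_yzxy_rev:
  "avoidable 4 {|[X,Y,Z,X], [Y,Z,X,Y], [ZR]|}"
  "avoidable 4 {|[X,Y,Z,X], [Y,ZR,X,Y]|}"
proof -
  \<comment> \<open>Shared by both formulas: \<open>z\<close> is the second letter of the second
    fragment and \<open>ps\<close> lists the fragments other than \<open>xyzx\<close>.\<close>
  have main: False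
    if ne: "\<And>x. h x \<noteq> []" and z: "z \<in> {Z, ZR}" and W: "factor wordD (rev (h vz))"
      and fx: "factor wordD (concat (map (img h) [X,Y,Z,X]))" "factor wordD (concat (map (img h) [Y,z,X,Y]))"
      and small: "small_free (windows DA DB 1 3 3 5) [X,Y,Z,X] ps [(1,1,1), (1,1,2)]"
      and ps: "\<forall>p\<in>set ps. factor wordD (concat (map (img h) p)) \<and> (p = [Y,z,X,Y] \<or> p = [ZR])"
    for h :: "var \<Rightarrow> nat list" and z ps
  proof -
    have lz: "length (img h z) = length (h vz)" using z by auto
    obtain i where i: "occ_at wordD i (h vx @ h vy @ h vz @ h vx)" using fx(1) by (auto simp: factor_def)
    obtain j where j: "occ_at wordD j (h vy @ img h z @ h vx @ h vy)" using fx(2) by (auto simp: factor_def)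
    have "factor wordD (h vz)" using i unfolding occ_at_append factor_def by blast
    then have c: "length (h vz) \<le> 2" using D_reversible W by blast
    have ab: "length (h vx) = 1 \<and> length (h vy) = 1"
      using D_xyzx_yzxy[OF i j] ne c lz by simp
    have "0 < length (h vz)" using ne by simp
    then have "length (h vz) = 1 \<or> length (h vz) = 2" using c by linarith
    then have mem: "(1, 1, length (h vz)) \<in> set [(1,1,1), (1,1,2)]" by auto
    have "var_of ` set [X,Y,Z,X] = UNIV" by (auto intro: var.exhaust)
    then have vars: "\<forall>p\<in>set ps. var_of ` set p \<subseteq> var_of ` set [X,Y,Z,X]" by simp
    have len: "length (concat (map (img h) p)) \<le> 5" if "p \<in> set ps" for p
      using ps that ab c lz by fastforce
    show False
      by (rule D.small_freeD[OF small mem _ fx(1) _ _ _ vars]) (use ps ab c len in \<open>simp_all add: lens_def\<close>)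
  qed
  have less: "wordD n < 4" for n by (rule D.less_bound) (simp add: DA_def DB_def)
  show "avoidable 4 {|[X,Y,Z,X], [Y,Z,X,Y], [ZR]|}"
  proof (rule avoidableI[of wordD, OF less])
    fix h :: "var \<Rightarrow> nat list"
    assume ne: "\<And>x. h x \<noteq> []"
      and f: "\<And>p. p |\<in>| {|[X,Y,Z,X], [Y,Z,X,Y], [ZR]|} \<Longrightarrow> factor wordD (concat (map (img h) p))"
    have "factor wordD (concat (map (img h) [X,Y,Z,X]))" "factor wordD (concat (map (img h) [Y,Z,X,Y]))"
        "factor wordD (concat (map (img h) [ZR]))"
      by (rule f, simp)+
    then show False using main[OF ne _ _ _ _ D_small_xyzx(1), of Z] by simp
  qed
  show "avoidable 4 {|[X,Y,Z,X], [Y,ZR,X,Y]|}"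
  proof (rule avoidableI[of wordD, OF less])
    fix h :: "var \<Rightarrow> nat list"
    assume ne: "\<And>x. h x \<noteq> []"
      and f: "\<And>p. p |\<in>| {|[X,Y,Z,X], [Y,ZR,X,Y]|} \<Longrightarrow> factor wordD (concat (map (img h) p))"
    have fx: "factor wordD (concat (map (img h) [X,Y,Z,X]))" "factor wordD (concat (map (img h) [Y,ZR,X,Y]))"
      by (rule f, simp)+
    then have "factor wordD (rev (h vz))" by (auto dest: factor_appendD)
    then show False using main[OF ne _ _ _ _ D_small_xyzx(2), of ZR] fx by simp
  qed
qed

section \<open>Formulas avoided by \<open>wordE\<close>\<close>

lemma avoidable_xyzyx_zyxyz: "avoidable 4 {|[X,Y,Z,Y,X], [Z,Y,X,Y,Z]|}"
proof (rule avoidableI[of wordE])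
  show "wordE n < 4" for n by (rule E.less_bound) (simp add: EA_def EB_def)
next
  fix h :: "var \<Rightarrow> nat list"
  assume ne: "\<And>x. h x \<noteq> []"
    and f: "\<And>p. p |\<in>| {|[X,Y,Z,Y,X], [Z,Y,X,Y,Z]|} \<Longrightarrow> factor wordE (concat (map (img h) p))"
  define a b c where "a = length (h vx)" and "b = length (h vy)" and "c = length (h vz)"
  note l = a_def[symmetric] b_def[symmetric] c_def[symmetric]
  have pos: "0 < a" "0 < b" "0 < c" using ne unfolding a_def b_def c_def by simp_all
  obtain i where 1: "occ_at wordE i (h vx @ h vy @ h vz @ h vy @ h vx)"
    using f[of "[X,Y,Z,Y,X]"] by (auto simp: factor_def)
  obtain j where 2: "occ_at wordE j (h vz @ h vy @ h vx @ h vy @ h vz)"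
    using f[of "[Z,Y,X,Y,Z]"] by (auto simp: factor_def)
  let ?u = "a + b + c"
  have "agree wordE (i + a + b) j (length (h vz @ h vy @ h vx))"
    by (rule agree_occ_at) (use 1 2 in \<open>simp_all add: occ_at_append l ac_simps\<close>)
  moreover have "agree wordE i (j + c + b) (length (h vx @ h vy @ h vz))"
    by (rule agree_occ_at) (use 1 2 in \<open>simp_all add: occ_at_append l ac_simps\<close>)
  ultimately have ag: "agree wordE (i + a + b) j ?u" "agree wordE i (j + c + b) ?u"
    by (simp_all add: l ac_simps)
  obtain N where N: "2 ^ (2 - 1) * (?u + 2) \<le> N" "\<And>i j. agree wordE i j ?u \<Longrightarrow> [i = j] (mod N)"
    by (rule E.modulus[of ?u]) (use pos in simp_all)
  \<comment> \<open>\<open>zyx\<close> and \<open>xyz\<close> each occur in both fragments;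
    combining the displacements gives \<open>a + 2 * b + c\<close>. This is below
    \<open>2 * (?u + 2)\<close>, which is where \<open>e = 2\<close> is needed.\<close>
  have *: "n dvd i + a + b - j \<Longrightarrow> n dvd i - (j + c + b) \<Longrightarrow> n dvd a + 2 * b + c"
    for n i j a b c :: int by algebra
  have "int N dvd int a + 2 * int b + int c"
    by (rule *[of _ "int i" _ _ "int j"]) (use ag[THEN N(2)] in \<open>simp_all add: cong_dvd_int\<close>)
  then have "int N dvd int (a + 2 * b + c)" by simp
  then have "N dvd a + 2 * b + c" unfolding int_dvd_int_iff .
  moreover have "0 < a + 2 * b + c" using pos by simp
  ultimately have "N \<le> a + 2 * b + c" by (rule dvd_imp_le)
  then show False using N(1) pos by simp
qed

lemma avoidable_xyzx_yzxy_zyz: "avoidable 4 {|[X,Y,Z,X], [Y,Z,X,Y], [Z,Y,Z]|}"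
proof (rule avoidableI[of wordE])
  show "wordE n < 4" for n by (rule E.less_bound) (simp add: EA_def EB_def)
next
  fix h :: "var \<Rightarrow> nat list"
  assume ne: "\<And>x. h x \<noteq> []"
    and f: "\<And>p. p |\<in>| {|[X,Y,Z,X], [Y,Z,X,Y], [Z,Y,Z]|} \<Longrightarrow> factor wordE (concat (map (img h) p))"
  define a b c where "a = length (h vx)" and "b = length (h vy)" and "c = length (h vz)"
  note l = a_def[symmetric] b_def[symmetric] c_def[symmetric]
  have pos: "0 < a" "0 < b" "0 < c" using ne unfolding a_def b_def c_def by simp_all
  have fx: "factor wordE (concat (map (img h) [X,Y,Z,X]))" "factor wordE (concat (map (img h) [Y,Z,X,Y]))"
      "factor wordE (concat (map (img h) [Z,Y,Z]))"
    by (rule f, simp)+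
  obtain i where 1: "occ_at wordE i (h vx @ h vy @ h vz @ h vx)" using fx(1) by (auto simp: factor_def)
  obtain j where 2: "occ_at wordE j (h vy @ h vz @ h vx @ h vy)" using fx(2) by (auto simp: factor_def)
  obtain k where 3: "occ_at wordE k (h vz @ h vy @ h vz)" using fx(3) by (auto simp: factor_def)
  let ?p = "a + b + c"
  have x: "agree wordE i (i + ?p) a"
    using agree_occ_at[of wordE i "h vx" "i + ?p"] 1 by (simp add: occ_at_append l ac_simps)
  have y: "agree wordE j (j + ?p) b"
    using agree_occ_at[of wordE j "h vy" "j + ?p"] 2 by (simp add: occ_at_append l ac_simps)
  have z: "agree wordE k (k + (b + c)) c"
    using agree_occ_at[of wordE k "h vz" "k + (b + c)"] 3 by (simp add: occ_at_append l ac_simps)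
  have "agree wordE (i + a) j (length (h vy @ h vz @ h vx))"
    by (rule agree_occ_at) (use 1 2 in \<open>simp_all add: occ_at_append l ac_simps\<close>)
  then have yzx: "agree wordE (i + a) j ?p" by (simp add: l ac_simps)
  \<comment> \<open>\<open>zyz\<close> repeats \<open>z\<close> at distance \<open>b + c\<close>,
    which is at least the modulus, hence at least \<open>2 * (c + 2)\<close>.\<close>
  have cb: "c + 4 \<le> b" if c3: "3 \<le> c"
  proof -
    obtain N where N: "2 ^ (2 - 1) * (c + 2) \<le> N" "\<And>i j. agree wordE i j c \<Longrightarrow> [i = j] (mod N)"
      by (rule E.modulus[of c]) (use c3 in simp_all)
    have "\<not> b + c < N" using cong_self_add[OF N(2)[OF z]] pos by blast
    then show ?thesis using N(1) by simp
  qed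
  show False
  proof (cases "3 \<le> a \<or> 3 \<le> b")
    case False
    then have "a \<le> 2" "b \<le> 2" "c \<le> 2" using cb by linarith+
    moreover from this have "(a, b, c) \<in>
        set [(1,1,1), (1,1,2), (1,2,1), (1,2,2), (2,1,1), (2,1,2), (2,2,1), (2,2,2)]"
      using pos by (auto simp: le_Suc_eq numeral_2_eq_2)
    then show False
      by (rule E.small_freeD[OF E_small, where h = h])
        (use fx calculation in \<open>simp_all add: l lens_def\<close>)
  next
    case True
    then have "2 * 2 ^ 2 dvd ?p"
      using cong_self_addD[OF E.agree_base[OF x]] cong_self_addD[OF E.agree_base[OF y]] by blast
    then have "8 dvd ?p" by simp
    then obtain p' where p': "?p = 8 * p'" by blast
    have "0 < p'" using p' pos by simp
    then obtain r m where "p' = 2 ^ r * m" and m: "odd m" using odd_part by blast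
    then have pr: "?p = 2 * 2 ^ (r + 2) * m" using p' by simp
    let ?H = "2 * 2 ^ Suc r :: nat"
    have H: "4 \<le> ?H" by simp
    have nx: "\<not> E.hit r (i + s)" if "s < a" for s
      using E.agree_period(1)[of i r m a s] x[unfolded pr] m that by blast
    have ny: "\<not> E.hit r (j + s)" if "s < b" for s
      using E.agree_period(1)[of j r m b s] y[unfolded pr] m that by blast
    have la: "a + 2 \<le> ?H" using E.agree_period(2)[of i r m a] x[unfolded pr] m by blast
    have lb: "b + 2 \<le> ?H" using E.agree_period(2)[of j r m b] y[unfolded pr] m by blast
    have lc: "c < ?H" using cb lb H by linarith
    have "1 \<le> m" using m by (cases m) auto
    then have "?H * 2 * 1 \<le> ?H * 2 * m" by (intro mult_le_mono) auto
    then have p2: "?H * 2 \<le> ?p" unfolding pr by simp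
    have "?H < ?p + 2" using p2 H by linarith
    then have "[i + a = j] (mod 2 * 2 ^ (Suc r + 2))"
      using E.agree_cong[OF yzx, of "Suc r"] pos by simp
    moreover have "?H dvd 2 * 2 ^ (Suc r + 2)" by simp
    \<comment> \<open>\<open>?H\<close> is the period of the hits of level \<open>r\<close>, and
      both \<open>x\<close> and \<open>y\<close> avoid these hits. Since \<open>y\<close> at
      \<open>j\<close> may be placed right after \<open>x\<close> at \<open>i\<close>,
      \<open>xy\<close> avoids them too, so \<open>a + b + 2 \<le> ?H\<close>; with
      \<open>c < ?H\<close> this contradicts \<open>p2\<close>.\<close>
    ultimately have ij: "[i + a = j] (mod ?H)" using cong_dvd_modulus_nat by blast
    have "\<not> E.hit r (i + s)" if "s < a + b" for s
    proof (cases "s < a")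
      case True
      then show ?thesis by (rule nx)
    next
      case False
      then obtain t where t: "s = a + t" using le_Suc_ex by (metis not_less)
      then have "[i + s = j + t] (mod ?H)" using ij by (simp add: cong_add_rcancel_nat flip: add.assoc)
      then show ?thesis using E.hit_cong ny[of t] that t by simp
    qed
    then have "\<not> ?H < a + b + 2" using E.hit_in_interval[of r "a + b" i] by blast
    then show False using p2 lc by linarith
  qed
qed

lemma avoidable_xzyx_yxzy_zyz: "avoidable 4 {|[X,Z,Y,X], [Y,X,Z,Y], [Z,Y,Z]|}"
  using avoidable_mirror[OF avoidable_xyzx_yzxy_zyz] by simp

section \<open>The formula avoided by \<open>wordF\<close>\<close>

lemma F_reversible:
  assumes u: "factor wordF u" "factor wordF (rev u)"
  shows "length u \<le> 3" and "Suc s < length u \<Longrightarrow> u ! s = u ! Suc s"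
proof -
  show "length u \<le> 3"
    using F.reversible_bound[of 2 4 u] F_irreversible u unfolding irreversible_def by simp
  assume s: "Suc s < length u"
  \<comment> \<open>Two-letter factors of \<open>u\<close> are reversible as well, and in
    \<open>wordF\<close> such pairs consist of equal letters.\<close>
  let ?v = "[u ! s, u ! Suc s]"
  have "u = take s u @ ?v @ drop (Suc (Suc s)) u"
    using s by (simp add: Cons_nth_drop_Suc id_take_nth_drop)
  then have u': "u = (take s u @ ?v) @ drop (Suc (Suc s)) u" by simp
  then have "rev u = rev ((take s u @ ?v) @ drop (Suc (Suc s)) u)" by (rule arg_cong)
  then have ru': "rev u = (rev (drop (Suc (Suc s)) u) @ rev ?v) @ rev (take s u)"
    by (simp only: rev_append append_assoc)
  have "factor wordF ?v"
    using factor_appendD[of wordF "take s u @ ?v" "drop (Suc (Suc s)) u"] factor_appendD[of wordF "take s u" ?v]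
      u(1) u' by metis
  moreover have "factor wordF (rev ?v)"
    using factor_appendD[of wordF "rev (drop (Suc (Suc s)) u) @ rev ?v" "rev (take s u)"]
      factor_appendD[of wordF "rev (drop (Suc (Suc s)) u)" "rev ?v"] u(2) ru' by metis
  then have "prefix_in (windows FA FB 1 7 2 2) (rev ?v)"
    by (intro F.factor_prefix_in) simp_all
  moreover obtain i where "occ_at wordF i ?v" using \<open>factor wordF ?v\<close> unfolding factor_def by blast
  then have v: "map wordF [i..<i + 2] = ?v" unfolding occ_at_eq by simp
  have "2 + 7 \<le> 7 * 2 + (1 :: nat)" by simp
  from F.windows[OF this, of i] obtain x where "(x, ?v) \<in> set (windows FA FB 1 7 2 2)"
    unfolding v by blast
  then have "?v = rev ?v \<or> \<not> prefix_in (windows FA FB 1 7 2 2) (rev ?v)"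
    using bspec[OF F_reversible_pairs, of "(x, ?v)"] by (simp only: prod.case)
  ultimately have "?v = rev ?v" by blast
  then have "hd ?v = hd (rev ?v)" by (rule arg_cong)
  then show "u ! s = u ! Suc s" by simp
qed

lemma avoidable_xyzx_rev_rev: "avoidable 5 {|[X,Y,Z,X], [YR], [ZR]|}"
proof (rule avoidableI[of wordF])
  show "wordF n < 5" for n by (rule F.less_bound) (simp add: FA_def FB_def)
next
  fix h :: "var \<Rightarrow> nat list"
  assume ne: "\<And>x. h x \<noteq> []"
    and f: "\<And>p. p |\<in>| {|[X,Y,Z,X], [YR], [ZR]|} \<Longrightarrow> factor wordF (concat (map (img h) p))"
  define x y z where "x = h vx" and "y = h vy" and "z = h vz"
  define a b c where "a = length x" and "b = length y" and "c = length z"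
  note l = a_def[symmetric] b_def[symmetric] c_def[symmetric]
  have pos: "0 < a" "0 < b" "0 < c" using ne unfolding a_def b_def c_def x_def y_def z_def by simp_all
  have fx: "factor wordF (x @ y @ z @ x)" "factor wordF (rev y)" "factor wordF (rev z)"
    using f[of "[X,Y,Z,X]"] f[of "[YR]"] f[of "[ZR]"] by (simp_all add: x_def y_def z_def)
  obtain i where i: "occ_at wordF i (x @ y @ z @ x)" using fx(1) by (auto simp: factor_def)
  have fyz: "factor wordF y" "factor wordF z" using i unfolding occ_at_append factor_def by blast+
  have b: "b \<le> 3" and c: "c \<le> 3"
    using F_reversible(1) fyz fx(2,3) unfolding b_def c_def by blast+
  show False
  proof (cases "a < 7")
    case True
    \<comment> \<open>18 = 6 + 3 + 3 + 6 is the greatest length of the image of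
      \<open>xyzx\<close>.\<close>
    have "prefix_in (windows FA FB 1 7 4 18) (x @ y @ z @ x)"
      using F.factor_prefix_in[OF fx(1), of 18 4] True b c by (simp add: l)
    then obtain n v where v: "(n, v) \<in> set (windows FA FB 1 7 4 18)"
        "take (length (x @ y @ z @ x)) v = x @ y @ z @ x"
      unfolding prefix_in_def by blast
    from v(2) have "v = (x @ y @ z @ x) @ drop (length (x @ y @ z @ x)) v"
      by (metis append_take_drop_id)
    then obtain r where r: "v = x @ y @ z @ x @ r" by simp
    have shift: "take (length u - 1) (u @ s) = take (length u - 1) (drop 1 (u @ s))"
      if "factor wordF u" "factor wordF (rev u)" for u s
      using F_reversible(2)[OF that] by (intro nth_equalityI) (auto simp: nth_append)
    have "take a v = take a (drop (a + b + c) v)" unfolding r by (simp add: l)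
    moreover have "take (b - 1) (drop a v) = take (b - 1) (drop (a + 1) v)"
      using shift[OF fyz(1) fx(2), of "z @ x @ r"] unfolding r by (simp add: l)
    moreover have "take (c - 1) (drop (a + b) v) = take (c - 1) (drop (a + b + 1) v)"
      using shift[OF fyz(2) fx(3), of "x @ r"] unfolding r by (simp add: l)
    moreover have "a \<in> set [1,2,3,4,5,6]" "b \<in> set [1,2,3]" "c \<in> set [1,2,3]"
      using pos True b c by auto
    then have "(a, b, c) \<in> set (List.product [1,2,3,4,5,6] (List.product [1,2,3] [1,2,3]))"
      unfolding set_product by blast
    ultimately show False using F_power_free v(1) unfolding power_free_def by blast
  next
    case False
    have ag: "agree wordF i (i + (a + b + c)) a"
      using agree_occ_at[of wordF i x "i + (a + b + c)"] i
      by (simp add: occ_at_append l ac_simps)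
    obtain N where "2 ^ (1 - 1) * (a + 7) \<le> N"
        and "\<And>i j. agree wordF i j a \<Longrightarrow> [i = j] (mod N)"
      by (rule F.modulus[of a]) (use False pos in simp_all)
    \<comment> \<open>The distance is at most \<open>a + 6\<close>, below the modulus.\<close>
    then show False using cong_self_add[of i "a + b + c" N] ag pos b c by simp
  qed
qed

section \<open>Unavoidability\<close>

text \<open>A finite substitute for being a factor of a bi-infinite avoiding word; no limit is
  constructed.\<close>

definition persistent :: "nat \<Rightarrow> 'v formula \<Rightarrow> nat list \<Rightarrow> bool" where
  "persistent k \<phi> u \<longleftrightarrow> (\<forall>n. \<exists>p s. n \<le> length p \<and> n \<le> length s \<and>
     p @ u @ s \<in> lists {..<k} \<and> avoids (p @ u @ s) \<phi>)"

lemma persistentD: "persistent k \<phi> u \<Longrightarrow> u \<in> lists {..<k}"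
  unfolding persistent_def by (metis append_in_lists_conv)

lemma occurs_sublist: "occurs \<phi> u \<Longrightarrow> sublist u w \<Longrightarrow> occurs \<phi> w"
  unfolding occurs_def using sublist_order.order.trans by blast

lemma persistent_avoids:
  assumes "persistent k \<phi> u"
  shows "\<not> occurs \<phi> u"
proof -
  obtain p s where "avoids (p @ u @ s) \<phi>" using assms unfolding persistent_def by blast
  then show ?thesis unfolding avoids_def using occurs_sublist[of \<phi> u "p @ u @ s"] by auto
qed

lemma persistent_Nil:
  assumes "avoidable k \<phi>"
  shows "persistent k \<phi> []"
  unfolding persistent_def
proof
  fix n
  have "finite {w. set w \<subseteq> {..<k} \<and> length w \<le> 2 * n}" by (rule finite_lists_length_le) simp
  then have "\<not> {w \<in> lists {..<k}. avoids w \<phi>} \<subseteq> {w. set w \<subseteq> {..<k} \<and> length w \<le> 2 * n}"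
    using assms finite_subset unfolding avoidable_def by blast
  then obtain w where w: "w \<in> lists {..<k}" "avoids w \<phi>" "\<not> length w \<le> 2 * n"
    by (auto simp: in_lists_conv_set subset_iff)
  then show "\<exists>p s. n \<le> length p \<and> n \<le> length s \<and>
     p @ [] @ s \<in> lists {..<k} \<and> avoids (p @ [] @ s) \<phi>"
    by - (rule exI[of _ "take n w"], rule exI[of _ "drop n w"], simp)
qed

text \<open>If every letter \<open>c\<close> failed from some length \<open>f c\<close> on, an
  extension longer than all these bounds would still begin with one of these letters.\<close>

lemma persistent_append:
  assumes "persistent k \<phi> u"
  shows "\<exists>c<k. persistent k \<phi> (u @ [c])"
proof (rule ccontr)
  assume "\<not> (\<exists>c<k. persistent k \<phi> (u @ [c]))"
  then have neg: "\<not> persistent k \<phi> (u @ [c])" if "c < k" for c using that by blast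
  have "\<exists>n. c < k \<longrightarrow> (\<forall>p s. \<not> (n \<le> length p \<and> n \<le> length s \<and>
      p @ (u @ [c]) @ s \<in> lists {..<k} \<and> avoids (p @ (u @ [c]) @ s) \<phi>))" for c
    using neg[of c] unfolding persistent_def not_all not_ex by (cases "c < k") simp_all
  then have "\<forall>c. \<exists>n. c < k \<longrightarrow> (\<forall>p s. \<not> (n \<le> length p \<and> n \<le> length s \<and>
      p @ (u @ [c]) @ s \<in> lists {..<k} \<and> avoids (p @ (u @ [c]) @ s) \<phi>))" ..
  from choice[OF this] obtain f where f: "\<forall>c. c < k \<longrightarrow> (\<forall>p s. \<not> (f c \<le> length p \<and> f c \<le> length s \<and>
      p @ (u @ [c]) @ s \<in> lists {..<k} \<and> avoids (p @ (u @ [c]) @ s) \<phi>))" ..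
  \<comment> \<open>The sum bounds every \<open>f c\<close>, and \<open>Suc\<close> pays for the
    letter removed from \<open>s\<close>.\<close>
  define N where "N = Suc (sum f {..<k})"
  obtain p s where ps: "N \<le> length p" "N \<le> length s" "p @ u @ s \<in> lists {..<k}" "avoids (p @ u @ s) \<phi>"
    using assms unfolding persistent_def by blast
  have "s \<noteq> []" using ps(2) unfolding N_def by auto
  then obtain c s' where s: "s = c # s'" by (cases s) blast+
  have c: "c < k" using ps(3) s by simp
  then have "f c \<le> sum f {..<k}" by (intro member_le_sum) auto
  then have l: "f c \<le> length p" "f c \<le> length s'" using ps(1,2) s unfolding N_def by simp_all
  have e: "p @ (u @ [c]) @ s' = p @ u @ s" using s by simp
  have "p @ (u @ [c]) @ s' \<in> lists {..<k}" "avoids (p @ (u @ [c]) @ s') \<phi>"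
    unfolding e by (fact ps(3,4))+
  then show False using f c l by blast
qed

lemma persistent_Cons:
  assumes "persistent k \<phi> u"
  shows "\<exists>c<k. persistent k \<phi> (c # u)"
proof (rule ccontr)
  assume "\<not> (\<exists>c<k. persistent k \<phi> (c # u))"
  then have neg: "\<not> persistent k \<phi> (c # u)" if "c < k" for c using that by blast
  have "\<exists>n. c < k \<longrightarrow> (\<forall>p s. \<not> (n \<le> length p \<and> n \<le> length s \<and>
      p @ (c # u) @ s \<in> lists {..<k} \<and> avoids (p @ (c # u) @ s) \<phi>))" for c
    using neg[of c] unfolding persistent_def not_all not_ex by (cases "c < k") simp_all
  then have "\<forall>c. \<exists>n. c < k \<longrightarrow> (\<forall>p s. \<not> (n \<le> length p \<and> n \<le> length s \<and>
      p @ (c # u) @ s \<in> lists {..<k} \<and> avoids (p @ (c # u) @ s) \<phi>))" ..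
  from choice[OF this] obtain f where f: "\<forall>c. c < k \<longrightarrow> (\<forall>p s. \<not> (f c \<le> length p \<and> f c \<le> length s \<and>
      p @ (c # u) @ s \<in> lists {..<k} \<and> avoids (p @ (c # u) @ s) \<phi>))" ..
  define N where "N = Suc (sum f {..<k})"
  obtain p s where ps: "N \<le> length p" "N \<le> length s" "p @ u @ s \<in> lists {..<k}" "avoids (p @ u @ s) \<phi>"
    using assms unfolding persistent_def by blast
  have "p \<noteq> []" using ps(1) unfolding N_def by auto
  then obtain c p' where p: "p = p' @ [c]" by (cases p rule: rev_cases) blast+
  have c: "c < k" using ps(3) p by simp
  then have "f c \<le> sum f {..<k}" by (intro member_le_sum) auto
  then have l: "f c \<le> length p'" "f c \<le> length s" using ps(1,2) p unfolding N_def by simp_all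
  have e: "p' @ (c # u) @ s = p @ u @ s" using p by simp
  have "p' @ (c # u) @ s \<in> lists {..<k}" "avoids (p' @ (c # u) @ s) \<phi>"
    unfolding e by (fact ps(3,4))+
  then show False using f c l by blast
qed

lemma persistent_sublist:
  assumes "persistent k \<phi> (u1 @ u @ u2)"
  shows "persistent k \<phi> u"
  unfolding persistent_def
proof
  fix n
  obtain p s where "n \<le> length p" "n \<le> length s" "p @ (u1 @ u @ u2) @ s \<in> lists {..<k}"
      "avoids (p @ (u1 @ u @ u2) @ s) \<phi>"
    using assms unfolding persistent_def by blast
  then show "\<exists>p s. n \<le> length p \<and> n \<le> length s \<and> p @ u @ s \<in> lists {..<k} \<and> avoids (p @ u @ s) \<phi>"
    by - (rule exI[of _ "p @ u1"], rule exI[of _ "u2 @ s"], simp)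
qed

lemma occurs_map:
  assumes "occurs \<phi> w"
  shows "occurs \<phi> (map f w)"
proof -
  obtain h where h: "\<forall>x. h x \<noteq> []" "\<forall>p. p |\<in>| \<phi> \<longrightarrow> sublist (concat (map (img h) p)) w"
    using assms unfolding occurs_iff by blast
  have im: "img (\<lambda>x. map f (h x)) c = map f (img h c)" for c by (cases c) (simp_all add: rev_map)
  have cm: "concat (map (img (\<lambda>x. map f (h x))) p) = map f (concat (map (img h) p))" for p
    by (induction p) (simp_all add: im)
  have "\<forall>p. p |\<in>| \<phi> \<longrightarrow> sublist (concat (map (img (\<lambda>x. map f (h x))) p)) (map f w)"
    unfolding cm using h(2) by (simp add: map_mono_sublist)
  then show ?thesis unfolding occurs_iff using h(1) by (intro exI[of _ "\<lambda>x. map f (h x)"]) simp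
qed

lemma persistent_map:
  assumes "persistent k \<phi> u" "bij_betw f {..<k} {..<k}"
  shows "persistent k \<phi> (map f u)"
  unfolding persistent_def
proof
  fix n
  obtain p s where ps: "n \<le> length p" "n \<le> length s" "p @ u @ s \<in> lists {..<k}"
      "avoids (p @ u @ s) \<phi>"
    using assms unfolding persistent_def by blast
  let ?g = "the_inv_into {..<k} f"
  have "map ?g (map f v) = v" if "v \<in> lists {..<k}" for v
    using that assms(2) unfolding bij_betw_def by (induction v) (simp_all add: the_inv_into_f_f)
  then have "map ?g (map f (p @ u @ s)) = p @ u @ s" using ps(3) by blast
  then have "avoids (map f (p @ u @ s)) \<phi>"
    using ps(4) occurs_map[of \<phi> "map f (p @ u @ s)" ?g] unfolding avoids_def by metis
  moreover have "map f (p @ u @ s) \<in> lists {..<k}"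
    using ps(3) assms(2) unfolding bij_betw_def by (auto simp: in_lists_conv_set)
  ultimately show "\<exists>p s. n \<le> length p \<and> n \<le> length s \<and> p @ map f u @ s \<in> lists {..<k} \<and>
      avoids (p @ map f u @ s) \<phi>"
    using ps(1,2) by - (rule exI[of _ "map f p"], rule exI[of _ "map f s"], simp)
qed

lemma persistent_rev:
  assumes "persistent k \<phi> u" and sym: "\<And>w :: nat list. occurs \<phi> w \<Longrightarrow> occurs \<phi> (rev w)"
  shows "persistent k \<phi> (rev u)"
  unfolding persistent_def
proof
  fix n
  obtain p s where ps: "n \<le> length p" "n \<le> length s" "p @ u @ s \<in> lists {..<k}"
      "avoids (p @ u @ s) \<phi>"
    using assms unfolding persistent_def by blast
  have "avoids (rev (p @ u @ s)) \<phi>" using ps(4) sym[of "rev (p @ u @ s)"] unfolding avoids_def by auto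
  then show "\<exists>p s. n \<le> length p \<and> n \<le> length s \<and> p @ rev u @ s \<in> lists {..<k} \<and>
      avoids (p @ rev u @ s) \<phi>"
    using ps(1-3) by - (rule exI[of _ "rev s"], rule exI[of _ "rev p"], auto simp: in_lists_conv_set)
qed

text \<open>Equality up to renaming of letters, tested on pairs of positions so that no permutations
  are enumerated.\<close>

definition same_pattern :: "'a list \<Rightarrow> 'a list \<Rightarrow> bool" where
  "same_pattern u v \<longleftrightarrow> length u = length v \<and>
     (\<forall>(a, b)\<in>set (zip u v). \<forall>(c, d)\<in>set (zip u v). (a = c) = (b = d))"

text \<open>Corresponding positions give a bijection between the letters of \<open>u\<close> and
  \<open>v\<close>; the complements in \<open>S\<close> are equally large, so it extends to
  \<open>S\<close>.\<close>

lemma same_pattern_bij: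
  assumes "same_pattern u v" "set u \<subseteq> S" "set v \<subseteq> S" "finite S"
  shows "\<exists>f. bij_betw f S S \<and> map f u = v"
proof -
  have l: "length u = length v" using assms(1) unfolding same_pattern_def by blast
  have eq: "(u ! i = u ! j) = (v ! i = v ! j)" if "i < length u" "j < length u" for i j
  proof -
    have "(u ! i, v ! i) \<in> set (zip u v)" "(u ! j, v ! j) \<in> set (zip u v)"
      using that l by (auto simp: set_zip)
    moreover have "\<forall>x\<in>set (zip u v). \<forall>y\<in>set (zip u v). (fst x = fst y) = (snd x = snd y)"
      using assms(1) unfolding same_pattern_def case_prod_beta by (rule conjunct2)
    ultimately show ?thesis by fastforce
  qed
  define g where "g a = v ! (SOME i. i < length u \<and> u ! i = a)" for a
  have g: "g (u ! i) = v ! i" if i: "i < length u" for i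
  proof -
    have "\<exists>j. j < length u \<and> u ! j = u ! i" using i by blast
    then have "(SOME j. j < length u \<and> u ! j = u ! i) < length u \<and>
        u ! (SOME j. j < length u \<and> u ! j = u ! i) = u ! i" by (rule someI_ex)
    then show ?thesis unfolding g_def using eq i by blast
  qed
  have m: "map g u = v" using l g by (intro nth_equalityI) simp_all
  have "inj_on g (set u)"
  proof (rule inj_onI)
    fix a b assume a: "a \<in> set u" and b: "b \<in> set u" and ab: "g a = g b"
    obtain i where i: "i < length u" "u ! i = a" using a unfolding in_set_conv_nth by blast
    obtain j where j: "j < length u" "u ! j = b" using b unfolding in_set_conv_nth by blast
    have "v ! i = v ! j" using g[OF i(1)] g[OF j(1)] i(2) j(2) ab by simp
    then show "a = b" using eq[OF i(1) j(1)] i(2) j(2) by simp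
  qed
  then have bg: "bij_betw g (set u) (set v)" unfolding bij_betw_def m[symmetric] by simp
  then have "card (set u) = card (set v)" by (rule bij_betw_same_card)
  then have "card (S - set u) = card (S - set v)" using assms(2-4) by (simp add: card_Diff_subset)
  then obtain g' where bg': "bij_betw g' (S - set u) (S - set v)"
    using finite_same_card_bij[of "S - set u" "S - set v"] assms(4) by auto
  let ?f = "\<lambda>a. if a \<in> set u then g a else g' a"
  have "bij_betw ?f (set u \<union> (S - set u)) (set v \<union> (S - set v))"
  proof (rule bij_betw_combine)
    show "bij_betw ?f (set u) (set v)" using bg bij_betw_cong[of "set u" ?f g] by simp
    show "bij_betw ?f (S - set u) (S - set v)" using bg' bij_betw_cong[of "S - set u" ?f g'] by simp
  qed auto
  moreover have "set u \<union> (S - set u) = S" "set v \<union> (S - set v) = S" using assms(2,3) by auto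
  moreover have "map ?f u = v" using m by (simp cong: map_cong)
  ultimately show ?thesis by metis
qed

text \<open>Looking at the two ends suffices, since trees grow only there. If \<open>u\<close> is
  shorter than \<open>p\<close>, the lengths in \<open>same_pattern\<close> differ and the test
  fails.\<close>

definition banned :: "nat list list \<Rightarrow> nat list \<Rightarrow> bool" where
  "banned B u \<longleftrightarrow> (\<exists>p\<in>set B. same_pattern (take (length p) u) p \<or>
     same_pattern (drop (length u - length p) u) p)"

text \<open>A tree certifies that a word is not persistent: an inner node lists the extensions of the word by
  one letter, to the right or to the left, and a leaf contains a forbidden prefix or suffix. Over
  fewer than four letters the last subtrees are dummies.\<close>

datatype tree = Leaf | ExtR tree tree tree tree | ExtL tree tree tree tree

fun refutes :: "(nat list \<Rightarrow> bool) \<Rightarrow> nat \<Rightarrow> nat list list \<Rightarrow> tree \<Rightarrow> nat list \<Rightarrow> bool" where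
  "refutes C k B Leaf u \<longleftrightarrow> banned B u \<or> C u"
| "refutes C k B (ExtR t0 t1 t2 t3) u \<longleftrightarrow>
     (k \<le> 0 \<or> refutes C k B t0 (u @ [0])) \<and> (k \<le> 1 \<or> refutes C k B t1 (u @ [1])) \<and>
     (k \<le> 2 \<or> refutes C k B t2 (u @ [2])) \<and> (k \<le> 3 \<or> refutes C k B t3 (u @ [3]))"
| "refutes C k B (ExtL t0 t1 t2 t3) u \<longleftrightarrow>
     (k \<le> 0 \<or> refutes C k B t0 (0 # u)) \<and> (k \<le> 1 \<or> refutes C k B t1 (1 # u)) \<and>
     (k \<le> 2 \<or> refutes C k B t2 (2 # u)) \<and> (k \<le> 3 \<or> refutes C k B t3 (3 # u))"

lemma not_banned:
  assumes B: "\<forall>p\<in>set B. \<not> persistent k \<phi> p \<and> p \<in> lists {..<k}" and u: "persistent k \<phi> u"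
  shows "\<not> banned B u"
proof
  assume "banned B u"
  then obtain p v v1 v2 where p: "p \<in> set B" and v: "u = v1 @ v @ v2" "same_pattern v p"
    unfolding banned_def by (metis append_Nil append_Nil2 append_take_drop_id)
  have vp: "persistent k \<phi> v" using u persistent_sublist unfolding v(1) by blast
  then have "set v \<subseteq> {..<k}" "set p \<subseteq> {..<k}" using persistentD B p by (auto simp: in_lists_conv_set)
  then obtain f where "bij_betw f {..<k} {..<k}" "map f v = p"
    using same_pattern_bij[OF v(2)] by blast
  then show False using persistent_map[OF vp] B p by blast
qed

lemma refutes:
  assumes C: "\<And>u. C u \<Longrightarrow> occurs \<phi> u" and k: "k \<le> 4"
    and B: "\<forall>p\<in>set B. \<not> persistent k \<phi> p \<and> p \<in> lists {..<k}"
  shows "refutes C k B t u \<Longrightarrow> \<not> persistent k \<phi> u"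
proof (induction t arbitrary: u)
  case Leaf
  then have "banned B u \<or> C u" by simp
  then show ?case using not_banned[OF B, of u] persistent_avoids[of k \<phi> u] C[of u] by blast
next
  case (ExtR t0 t1 t2 t3)
  have "\<not> persistent k \<phi> (u @ [c])" if c: "c < k" for c
  proof -
    have "c = 0 \<or> c = 1 \<or> c = 2 \<or> c = 3" using c k by linarith
    then show ?thesis by (elim disjE) (use c ExtR.prems ExtR.IH in simp_all)
  qed
  then show ?case using persistent_append[of k \<phi> u] by blast
next
  case (ExtL t0 t1 t2 t3)
  have "\<not> persistent k \<phi> (c # u)" if c: "c < k" for c
  proof -
    have "c = 0 \<or> c = 1 \<or> c = 2 \<or> c = 3" using c k by linarith
    then show ?thesis by (elim disjE) (use c ExtL.prems ExtL.IH in simp_all)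
  qed
  then show ?case using persistent_Cons[of k \<phi> u] by blast
qed

section \<open>Computable tests for occurrences in a finite word\<close>

definition reversible_in :: "'a list \<Rightarrow> 'a list \<Rightarrow> bool" where
  "reversible_in u y \<longleftrightarrow> (\<exists>t\<in>set (suffixes u). take (length y) t = rev y)"

lemma reversible_in: "reversible_in u y \<Longrightarrow> sublist (rev y) u"
proof -
  assume "reversible_in u y"
  then obtain t where t: "suffix t u" "take (length y) t = rev y" unfolding reversible_in_def by auto
  have "prefix (take (length y) t) t" by (rule take_is_prefix)
  then show "sublist (rev y) u" unfolding t(2)
    using t(1) by (meson prefix_imp_sublist sublist_order.order.trans suffix_imp_sublist)
qed

text \<open>Sound but incomplete: the image of \<open>xyx\<close> is sought only at the ends of
  \<open>u\<close>, with at most 3 letters for \<open>y\<close>; the reversed \<open>y\<close> may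
  be anywhere in \<open>u\<close>.\<close>

definition xyx_ends :: "nat list \<Rightarrow> bool" where
  "xyx_ends u \<longleftrightarrow> (\<exists>b\<in>set [1,2,3]. \<exists>a\<in>set [1..<length u]. 2 * a + b \<le> length u \<and>
     (\<exists>v\<in>set [take (2 * a + b) u, drop (length u - (2 * a + b)) u].
        take a v = drop (a + b) v \<and> reversible_in u (take b (drop a v))))"

definition xyzx_ends :: "nat list \<Rightarrow> bool" where
  "xyzx_ends u \<longleftrightarrow> (\<exists>b\<in>set [1,2,3]. \<exists>c\<in>set [1,2,3]. \<exists>a\<in>set [1..<length u]. 2 * a + (b + c) \<le> length u \<and>
     (\<exists>v\<in>set [take (2 * a + (b + c)) u, drop (length u - (2 * a + (b + c))) u].
        take a v = drop (a + (b + c)) v \<and> reversible_in u (take b (drop a v)) \<and>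
        reversible_in u (take c (drop (a + b) v))))"

definition assign :: "'a list \<Rightarrow> 'a list \<Rightarrow> 'a list \<Rightarrow> var \<Rightarrow> 'a list" where
  "assign x y z v = (case v of vx \<Rightarrow> x | vy \<Rightarrow> y | vz \<Rightarrow> z)"

lemma occursI:
  assumes "x \<noteq> []" "y \<noteq> []" "z \<noteq> []"
    and "\<And>p. p |\<in>| \<phi> \<Longrightarrow> sublist (concat (map (img (assign x y z)) p)) w"
  shows "occurs \<phi> w"
  unfolding occurs_iff
proof (intro exI conjI allI impI)
  show "assign x y z v \<noteq> []" for v using assms(1-3) unfolding assign_def by (cases v) simp_all
qed (rule assms(4))

lemma ends_sublist:
  assumes "v \<in> set [take n u, drop (length u - n) u]" "n \<le> length u"
  shows "sublist v u" "length v = n"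
  using assms by (auto intro: prefix_imp_sublist take_is_prefix suffix_imp_sublist suffix_drop)

lemma split_at: "take a v @ take b (drop a v) @ drop (a + b) v = v"
proof -
  have "drop (a + b) v = drop b (drop a v)" by (simp add: add.commute)
  then show ?thesis by (simp only: append_take_drop_id)
qed

lemma xyx_ends_occurs:
  assumes "xyx_ends u"
  shows "occurs {|[X,Y,X], [YR]|} u"
proof -
  obtain a b v where m: "b \<in> set [1,2,3]" "a \<in> set [1..<length u]" and n: "2 * a + b \<le> length u"
    and v: "v \<in> set [take (2 * a + b) u, drop (length u - (2 * a + b)) u]"
    and x: "take a v = drop (a + b) v" and r: "reversible_in u (take b (drop a v))"
    using assms unfolding xyx_ends_def by blast
  have ab: "0 < a" "0 < b" using m by auto
  note s = ends_sublist[OF v n]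
  have "take a v @ take b (drop a v) @ take a v = v"
    using split_at[of a v b] unfolding x[symmetric] .
  then have "sublist (take a v @ take b (drop a v) @ take a v) u"
    using s(1) by (rule ssubst[where P = "\<lambda>w. sublist w u"])
  then show ?thesis
    using s(2) ab reversible_in[OF r]
    \<comment> \<open>The third word is a nonempty filler for \<open>vz\<close>, which is absent
      from the formula.\<close>
    by (intro occursI[of "take a v" "take b (drop a v)" "take a v"]) (auto simp: assign_def)
qed

lemma xyzx_ends_occurs:
  assumes "xyzx_ends u"
  shows "occurs {|[X,Y,Z,X], [YR], [ZR]|} u"
proof -
  obtain a b c v where m: "b \<in> set [1,2,3]" "c \<in> set [1,2,3]" "a \<in> set [1..<length u]"
    and n: "2 * a + (b + c) \<le> length u"
    and v: "v \<in> set [take (2 * a + (b + c)) u, drop (length u - (2 * a + (b + c))) u]"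
    and x: "take a v = drop (a + (b + c)) v" and r: "reversible_in u (take b (drop a v))"
      "reversible_in u (take c (drop (a + b) v))"
    using assms unfolding xyzx_ends_def by blast
  have ab: "0 < a" "0 < b" "0 < c" using m by auto
  note s = ends_sublist[OF v n]
  have "drop b (drop a v) = drop (a + b) v" by (simp add: add.commute)
  then have "take (b + c) (drop a v) = take b (drop a v) @ take c (drop (a + b) v)"
    unfolding take_add by (simp only:)
  then have "take a v @ (take b (drop a v) @ take c (drop (a + b) v)) @ drop (a + (b + c)) v = v"
    using split_at[of a v "b + c"] by (simp only:)
  then have "take a v @ take b (drop a v) @ take c (drop (a + b) v) @ take a v = v"
    unfolding x[symmetric] append_assoc .
  then have "sublist (take a v @ take b (drop a v) @ take c (drop (a + b) v) @ take a v) u"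
    using s(1) by (rule ssubst[where P = "\<lambda>w. sublist w u"])
  then show ?thesis
    using s(2) ab reversible_in[OF r(1)] reversible_in[OF r(2)]
    by (intro occursI[of "take a v" "take b (drop a v)" "take c (drop (a + b) v)"]) (auto simp: assign_def)
qed

lemma occurs_xyx_rev: "occurs {|[X,Y,X], [YR]|} w \<Longrightarrow> occurs {|[X,Y,X], [YR]|} (rev w)"
  using occurs_mirror[of "{|[X,Y,X], [YR]|}" w] by simp

text \<open>Mirroring turns \<open>xyzx\<close> into \<open>xzyx\<close>, so the reversed images of
  \<open>y\<close> and \<open>z\<close> are exchanged.\<close>

lemma occurs_xyzx_rev:
  assumes "occurs {|[X,Y,Z,X], [YR], [ZR]|} w"
  shows "occurs {|[X,Y,Z,X], [YR], [ZR]|} (rev w)"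
proof -
  obtain h where h: "\<forall>x. h x \<noteq> []"
    "\<forall>p. p |\<in>| {|[X,Y,Z,X], [YR], [ZR]|} \<longrightarrow> sublist (concat (map (img h) p)) w"
    using assms unfolding occurs_iff by blast
  have "sublist (h vx @ h vy @ h vz @ h vx) w" "sublist (rev (h vy)) w" "sublist (rev (h vz)) w"
    using h(2)[rule_format, of "[X,Y,Z,X]"] h(2)[rule_format, of "[YR]"] h(2)[rule_format, of "[ZR]"]
    by simp_all
  then have "sublist (rev (h vx @ h vy @ h vz @ h vx)) (rev w)" "sublist (rev (rev (h vy))) (rev w)"
      "sublist (rev (rev (h vz))) (rev w)"
    by (simp_all only: sublist_rev)
  then show ?thesis using h(1)
    by (intro occursI[of "rev (h vx)" "rev (h vz)" "rev (h vy)"]) (auto simp: assign_def)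
qed

text \<open>The banned list grows along the certificate, so the order of the words matters.\<close>

fun refutes_all ::
    "(nat list \<Rightarrow> bool) \<Rightarrow> nat \<Rightarrow> nat list list \<Rightarrow> (nat list \<times> tree) list \<Rightarrow> bool" where
  "refutes_all C k B [] \<longleftrightarrow> True"
| "refutes_all C k B ((u, t) # us) \<longleftrightarrow>
     list_all (\<lambda>c. c < k) u \<and> refutes C k B t u \<and> refutes_all C k (u # rev u # B) us"

lemma refutes_both:
  assumes r: "refutes C k B t u" and k: "k \<le> 4" "u \<in> lists {..<k}"
    and C: "\<And>u. C u \<Longrightarrow> occurs \<phi> u" and sym: "\<And>w :: nat list. occurs \<phi> w \<Longrightarrow> occurs \<phi> (rev w)"
    and B: "\<forall>p\<in>set B. \<not> persistent k \<phi> p \<and> p \<in> lists {..<k}"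
  shows "\<forall>p\<in>set (u # rev u # B). \<not> persistent k \<phi> p \<and> p \<in> lists {..<k}"
proof -
  have "\<not> persistent k \<phi> u" using refutes[of C \<phi> k B, OF C k(1) B r] .
  moreover from this have "\<not> persistent k \<phi> (rev u)" using persistent_rev[of k \<phi> "rev u", OF _ sym] by auto
  ultimately show ?thesis using B k(2) by (simp add: in_lists_conv_set)
qed

text \<open>Every binary word of length 4 already contains a square of period 1 or 2.\<close>

definition square_in :: "nat list \<Rightarrow> bool" where
  "square_in u \<longleftrightarrow> (\<exists>a\<in>set [1,2]. \<exists>t\<in>set (suffixes u). 2 * a \<le> length t \<and> take a t = take a (drop a t))"

lemma square_in_occurs:
  assumes "square_in u"
  shows "occurs {|[X,X]|} u"
proof -
  obtain a t where m: "a \<in> set [1,2]" "t \<in> set (suffixes u)" and n: "2 * a \<le> length t"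
      and x: "take a t = take a (drop a t)"
    using assms unfolding square_in_def by blast
  have t: "0 < a" "suffix t u" using m by auto
  have "sublist (take (a + a) t) u"
    using t(2) by (meson prefix_imp_sublist sublist_order.order.trans suffix_imp_sublist take_is_prefix)
  then have "sublist (take a t @ take a t) u" using x unfolding take_add by simp
  then show ?thesis using t n
    by (intro occursI[of "take a t" "take a t" "take a t"]) (auto simp: assign_def)
qed

lemma refutes_all:
  assumes C: "\<And>u. C u \<Longrightarrow> occurs \<phi> u" and sym: "\<And>w :: nat list. occurs \<phi> w \<Longrightarrow> occurs \<phi> (rev w)"
    and k: "k \<le> 4"
  shows "refutes_all C k B us \<Longrightarrow> \<forall>p\<in>set B. \<not> persistent k \<phi> p \<and> p \<in> lists {..<k} \<Longrightarrow>
    u \<in> fst ` set us \<Longrightarrow> \<not> persistent k \<phi> u"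
proof (induction us arbitrary: B)
  case (Cons x us)
  obtain v t where x: "x = (v, t)" by (cases x)
  have r: "refutes C k B t v" and v: "v \<in> lists {..<k}" and us: "refutes_all C k (v # rev v # B) us"
    using Cons.prems(1) unfolding x by (auto simp: list_all_iff in_lists_conv_set)
  note both = refutes_both[OF r k v C sym Cons.prems(2)]
  show ?case
  proof (cases "u = v")
    case True
    then show ?thesis using both by simp
  next
    case False
    then have "u \<in> fst ` set us" using Cons.prems(3) x by auto
    then show ?thesis using Cons.IH[OF us both] by blast
  qed
qed simp

lemma not_avoidableI:
  assumes "refutes_all C k [] us" "[] \<in> fst ` set us" "k \<le> 4"
    and "\<And>u. C u \<Longrightarrow> occurs \<phi> u" "\<And>w :: nat list. occurs \<phi> w \<Longrightarrow> occurs \<phi> (rev w)"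
  shows "\<not> avoidable k \<phi>"
proof
  assume "avoidable k \<phi>"
  moreover have "\<not> persistent k \<phi> []"
    using refutes_all[of C \<phi> k "[]" us "[]"] assms by auto
  ultimately show False using persistent_Nil by blast
qed

lemma not_avoidable_xx: "\<not> avoidable 2 {|[X,X]|}"
proof (rule not_avoidableI)
  show "refutes_all square_in 2 []
    [([], ExtR (ExtR Leaf (ExtR (ExtR Leaf Leaf Leaf Leaf) Leaf Leaf Leaf) Leaf Leaf)
      (ExtR (ExtR Leaf (ExtR Leaf Leaf Leaf Leaf) Leaf Leaf) Leaf Leaf Leaf) Leaf Leaf)]"
    by code_simp
  show "occurs {|[X,X]|} (rev w)" if "occurs {|[X,X]|} w" for w :: "nat list"
    using occurs_mirror[OF that] by simp
qed (simp_all add: square_in_occurs)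

text \<open>Each word of a certificate is refuted using the words before it; the last word is empty.\<close>

definition cert_xyx :: "(nat list \<times> tree) list" where
  "cert_xyx = [
     ([0, 0, 1, 2], ExtL Leaf Leaf (ExtL Leaf Leaf (ExtR (ExtR Leaf Leaf Leaf Leaf) Leaf (ExtL
     Leaf Leaf Leaf Leaf) Leaf) Leaf) Leaf),
     ([0, 0, 1, 1, 2], ExtR Leaf Leaf (ExtR (ExtR (ExtR Leaf (ExtR Leaf Leaf Leaf Leaf) Leaf
     Leaf) Leaf Leaf Leaf) Leaf Leaf Leaf) Leaf),
     ([0, 0, 1], ExtR Leaf (ExtR Leaf Leaf Leaf Leaf) Leaf Leaf),
     ([0, 0], ExtR Leaf Leaf Leaf Leaf),
     ([0, 1], ExtR Leaf Leaf (ExtR (ExtR Leaf Leaf Leaf Leaf) Leaf Leaf Leaf) Leaf),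
     ([], ExtR (ExtR Leaf Leaf Leaf Leaf) (ExtR Leaf Leaf Leaf Leaf) (ExtR Leaf Leaf Leaf Leaf)
     Leaf)]"

lemma not_avoidable_xyx_rev: "\<not> avoidable 3 {|[X,Y,X], [YR]|}"
proof (rule not_avoidableI)
  show "refutes_all xyx_ends 3 [] cert_xyx" by code_simp
  show "[] \<in> fst ` set cert_xyx" by (simp add: cert_xyx_def)
qed (simp_all add: xyx_ends_occurs occurs_xyx_rev)

text \<open>Up to renaming, every word of three letters contains \<open>00\<close>,
  \<open>010\<close> or \<open>012\<close>. These are among the refuted words, which closes the last
  tree.\<close>

definition cert_xyzx :: "(nat list \<times> tree) list" where
  "cert_xyzx = [
     ([0, 1, 0, 2, 3], ExtL Leaf (ExtL Leaf Leaf Leaf (ExtR Leaf Leaf (ExtR Leaf Leaf Leaf (ExtR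
     Leaf Leaf Leaf Leaf)) (ExtL Leaf Leaf Leaf (ExtR Leaf Leaf Leaf (ExtR Leaf (ExtL Leaf Leaf
     Leaf Leaf) Leaf Leaf))))) Leaf Leaf),
     ([0, 0, 0, 1, 2, 1], ExtL Leaf Leaf Leaf (ExtR Leaf Leaf (ExtR Leaf Leaf Leaf (ExtR Leaf
     Leaf Leaf (ExtL Leaf Leaf Leaf (ExtL Leaf Leaf Leaf (ExtL Leaf Leaf (ExtR (ExtR (ExtR Leaf
     Leaf Leaf Leaf) Leaf Leaf Leaf) Leaf Leaf Leaf) Leaf))))) Leaf)),
     ([0, 0, 0, 1, 2, 3], ExtL Leaf Leaf Leaf (ExtR (ExtR (ExtR Leaf Leaf Leaf Leaf) Leaf Leaf
     Leaf) Leaf Leaf (ExtL Leaf Leaf Leaf (ExtL Leaf Leaf Leaf (ExtL Leaf Leaf (ExtR (ExtR (ExtR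
     Leaf Leaf Leaf Leaf) Leaf Leaf Leaf) Leaf Leaf Leaf) Leaf))))),
     ([0, 1, 0, 2, 2, 3], ExtL Leaf (ExtL Leaf Leaf Leaf (ExtR Leaf Leaf Leaf (ExtL Leaf Leaf
     Leaf (ExtL Leaf Leaf (ExtL Leaf Leaf Leaf Leaf) Leaf)))) Leaf Leaf),
     ([0, 1, 1, 2, 3, 0], ExtR (ExtR Leaf (ExtR Leaf (ExtL Leaf Leaf Leaf Leaf) Leaf Leaf) Leaf
     Leaf) (ExtR Leaf Leaf Leaf Leaf) Leaf Leaf),
     ([0, 1, 2, 2, 3, 0], ExtR (ExtL (ExtR (ExtR Leaf (ExtL Leaf Leaf Leaf Leaf) Leaf Leaf) Leaf
     Leaf Leaf) Leaf Leaf Leaf) Leaf Leaf Leaf),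
     ([0, 1, 0], ExtR Leaf (ExtR Leaf Leaf (ExtR Leaf Leaf (ExtR Leaf Leaf Leaf Leaf) Leaf) (ExtR
     Leaf Leaf Leaf (ExtR Leaf Leaf Leaf Leaf))) (ExtR Leaf Leaf (ExtR Leaf Leaf Leaf Leaf) Leaf)
     (ExtR Leaf Leaf Leaf (ExtR Leaf Leaf Leaf Leaf))),
     ([0, 1, 2], ExtR Leaf Leaf (ExtR Leaf Leaf (ExtR Leaf Leaf Leaf (ExtR (ExtR (ExtL (ExtR
     (ExtR Leaf (ExtL Leaf Leaf Leaf Leaf) Leaf Leaf) Leaf Leaf Leaf) Leaf Leaf Leaf) Leaf Leaf
     Leaf) Leaf Leaf (ExtR (ExtR (ExtL (ExtR (ExtL (ExtR Leaf Leaf Leaf Leaf) Leaf Leaf (ExtL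
     Leaf Leaf Leaf Leaf)) Leaf Leaf Leaf) Leaf Leaf Leaf) Leaf Leaf Leaf) Leaf Leaf (ExtR (ExtR
     (ExtL (ExtR (ExtR Leaf (ExtL Leaf Leaf Leaf (ExtL Leaf Leaf Leaf (ExtL Leaf Leaf (ExtL Leaf
     Leaf (ExtL Leaf Leaf Leaf Leaf) Leaf) Leaf))) Leaf Leaf) Leaf Leaf Leaf) Leaf Leaf Leaf)
     Leaf Leaf Leaf) Leaf Leaf Leaf)))) (ExtR Leaf Leaf Leaf (ExtR (ExtR (ExtL (ExtR (ExtL (ExtR
     Leaf Leaf Leaf Leaf) Leaf Leaf (ExtL Leaf Leaf Leaf Leaf)) Leaf Leaf Leaf) Leaf Leaf Leaf)
     Leaf Leaf Leaf) Leaf Leaf (ExtR (ExtR (ExtL (ExtR (ExtR Leaf (ExtL Leaf Leaf Leaf (ExtL Leaf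
     Leaf Leaf (ExtL Leaf Leaf (ExtL Leaf Leaf Leaf Leaf) Leaf))) Leaf Leaf) Leaf Leaf Leaf) Leaf
     Leaf Leaf) Leaf Leaf Leaf) Leaf Leaf Leaf)))) (ExtR (ExtR (ExtR Leaf Leaf Leaf Leaf) Leaf
     Leaf Leaf) Leaf Leaf (ExtR Leaf Leaf Leaf Leaf))),
     ([0, 1, 1, 2], ExtR Leaf Leaf (ExtR Leaf Leaf (ExtR Leaf Leaf Leaf (ExtR Leaf Leaf Leaf
     (ExtR (ExtR (ExtR (ExtR Leaf (ExtR Leaf (ExtL (ExtL Leaf Leaf Leaf (ExtL Leaf Leaf Leaf
     Leaf)) Leaf Leaf Leaf) Leaf Leaf) Leaf Leaf) (ExtR Leaf (ExtL Leaf Leaf Leaf Leaf) Leaf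
     Leaf) Leaf Leaf) Leaf Leaf Leaf) Leaf Leaf (ExtR (ExtR (ExtR (ExtR Leaf (ExtR Leaf (ExtL
     (ExtL Leaf Leaf Leaf (ExtL Leaf Leaf Leaf (ExtL Leaf Leaf (ExtL Leaf Leaf (ExtL Leaf (ExtL
     Leaf Leaf Leaf Leaf) Leaf Leaf) Leaf) Leaf))) Leaf Leaf Leaf) Leaf Leaf) Leaf Leaf) (ExtR
     Leaf (ExtL Leaf Leaf Leaf Leaf) Leaf Leaf) Leaf Leaf) Leaf Leaf Leaf) Leaf Leaf Leaf))))
     (ExtR Leaf Leaf Leaf (ExtR (ExtR (ExtR (ExtR Leaf (ExtR Leaf (ExtL (ExtL Leaf Leaf Leaf
     (ExtL Leaf Leaf Leaf Leaf)) Leaf Leaf Leaf) Leaf Leaf) Leaf Leaf) (ExtR Leaf (ExtL Leaf Leaf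
     Leaf Leaf) Leaf Leaf) Leaf Leaf) Leaf Leaf Leaf) Leaf Leaf (ExtR (ExtR (ExtR (ExtR Leaf
     (ExtR Leaf (ExtL (ExtL Leaf Leaf Leaf (ExtL Leaf Leaf Leaf (ExtL Leaf Leaf (ExtL Leaf Leaf
     Leaf Leaf) Leaf))) Leaf Leaf Leaf) Leaf Leaf) Leaf Leaf) (ExtR Leaf (ExtL Leaf Leaf Leaf
     Leaf) Leaf Leaf) Leaf Leaf) Leaf Leaf Leaf) Leaf Leaf Leaf)))) Leaf),
     ([0, 1, 1, 1, 2], ExtR Leaf Leaf (ExtR Leaf Leaf (ExtR Leaf Leaf Leaf (ExtR Leaf Leaf Leaf
     (ExtR Leaf Leaf Leaf (ExtR (ExtR (ExtR (ExtR Leaf (ExtR Leaf (ExtR Leaf (ExtL (ExtL Leaf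
     Leaf Leaf Leaf) Leaf Leaf Leaf) Leaf Leaf) Leaf Leaf) Leaf Leaf) Leaf Leaf Leaf) Leaf Leaf
     Leaf) Leaf Leaf Leaf)))) Leaf) Leaf),
     ([0, 0, 1], ExtL (ExtL Leaf Leaf Leaf Leaf) Leaf Leaf Leaf),
     ([0, 0], ExtR (ExtR Leaf Leaf Leaf Leaf) Leaf Leaf Leaf),
     ([], ExtR (ExtR Leaf (ExtR Leaf Leaf Leaf Leaf) (ExtR Leaf Leaf Leaf Leaf) (ExtR Leaf Leaf
     Leaf Leaf)) (ExtR (ExtR Leaf Leaf Leaf Leaf) Leaf (ExtR Leaf Leaf Leaf Leaf) (ExtR Leaf Leaf
     Leaf Leaf)) (ExtR (ExtR Leaf Leaf Leaf Leaf) (ExtR Leaf Leaf Leaf Leaf) Leaf (ExtR Leaf Leaf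
     Leaf Leaf)) (ExtR (ExtR Leaf Leaf Leaf Leaf) (ExtR Leaf Leaf Leaf Leaf) (ExtR Leaf Leaf Leaf
     Leaf) Leaf))]"

lemma not_avoidable_xyzx_rev_rev: "\<not> avoidable 4 {|[X,Y,Z,X], [YR], [ZR]|}"
proof (rule not_avoidableI)
  show "refutes_all xyzx_ends 4 [] cert_xyzx" by code_simp
  show "[] \<in> fst ` set cert_xyzx" by (simp add: cert_xyzx_def)
qed (simp_all add: xyzx_ends_occurs occurs_xyzx_rev)

section \<open>The avoidability indices\<close>

lemma avoidable_xyzyx_zyxyz_revs:
  "avoidable 4 {|[X,Y,Z,Y,X], [Z,Y,X,YR,Z]|}"
  "avoidable 4 {|[X,Y,Z,Y,X], [Z,YR,X,Y,Z]|}"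
  "avoidable 4 {|[X,Y,Z,Y,X], [Z,YR,X,YR,Z]|}"
  "avoidable 4 {|[X,Y,Z,YR,X], [Z,Y,X,YR,Z]|}"
  "avoidable 4 {|[X,Y,Z,YR,X], [Z,YR,X,Y,Z]|}"
  using D_small_xyzyx by (auto intro!: avoidable_xyzyx_zyxyz_rev simp del: fset_simps)

lemma arg_max_unique:
  fixes f :: "'a \<Rightarrow> enat"
  assumes "x \<in> A" "f x = m" "\<forall>y\<in>A - {x}. f y < m"
  shows "(\<exists>!y. is_arg_max f (\<lambda>y. y \<in> A) y) \<and> (\<forall>y. is_arg_max f (\<lambda>y. y \<in> A) y \<longrightarrow> f y = m)"
proof -
  have "is_arg_max f (\<lambda>y. y \<in> A) y \<longleftrightarrow> y = x" for y
  proof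
    assume y: "is_arg_max f (\<lambda>y. y \<in> A) y"
    show "y = x"
    proof (rule ccontr)
      assume "y \<noteq> x"
      then have "f y < f x" using y assms unfolding is_arg_max_def by blast
      then show False using y assms(1) unfolding is_arg_max_def by blast
    qed
  next
    assume "y = x"
    moreover have "\<not> f x < f z" if "z \<in> A" for z
      using assms that by (cases "z = x") (auto dest!: bspec[of _ _ z])
    ultimately show "is_arg_max f (\<lambda>y. y \<in> A) y" using assms(1) unfolding is_arg_max_def by blast
  qed
  then show ?thesis using assms(2) by simp
qed

lemma avoidable_Phi2:
  assumes "\<psi> \<in> Phi2 - {{|[X,Y,X], [YR]|}}"
  shows "avoidable 3 \<psi>"
  using assms avoidable_xx avoidable_mono[OF avoidable_xx_rev, of 3] avoidable_xyx_yxy avoidable_periodic_3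
  unfolding Phi2_def by auto

lemma avoidable_Phi3:
  assumes "\<psi> \<in> Phi3 - {{|[X,Y,Z,X], [YR], [ZR]|}}"
  shows "avoidable 4 \<psi>"
proof -
  consider "\<psi> = {|[X,Y,X], [YR]|}" | "\<psi> \<in> Phi2 - {{|[X,Y,X], [YR]|}}" | "\<psi> \<notin> Phi2" by blast
  then show ?thesis
  proof cases
    case 1
    then show ?thesis using avoidable_xyx_rev by simp
  next
    case 2
    then show ?thesis using avoidable_Phi2 avoidable_mono[of 3 \<psi> 4] by simp
  next
    case 3
    then show ?thesis
      using assms avoidable_periodic_4 avoidable_xyzyx_zyxyz avoidable_xyzyx_zyxyz_revs
        avoidable_xyzx_yzxy_zxyz avoidable_xyzx_yzxy_zyz avoidable_xzyx_yxzy_zyz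
        avoidable_xyzx_yzxy_rev avoidable_xy_xz_yx_zx_zy
      unfolding Phi3_def by auto
  qed
qed

theorem mainTheorem3:
  shows
    "(\<forall>(n, \<Phi>) \<in> {(1 :: nat, Phi1), (2, Phi2), (3, Phi3)}.
        (\<exists>!\<phi>. is_arg_max avoidability_index (\<lambda>\<psi>. \<psi> \<in> \<Phi>) \<phi>) \<and>
        (\<forall>\<phi>. is_arg_max avoidability_index (\<lambda>\<psi>. \<psi> \<in> \<Phi>) \<phi> \<longrightarrow>
              avoidability_index \<phi> = enat (n + 2))) \<and>
     ({|[X,X]|} \<in> Phi1 \<and> avoidability_index {|[X,X]|} = 3 \<and>
      (\<forall>\<psi> \<in> Phi1 - {{|[X,X]|}}. avoidability_index \<psi> < 3)) \<and>
     ({|[X,Y,X], [YR]|} \<in> Phi2 \<and> avoidability_index {|[X,Y,X], [YR]|} = 4 \<and>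
      (\<forall>\<psi> \<in> Phi2 - {{|[X,Y,X], [YR]|}}. avoidability_index \<psi> < 4)) \<and>
     ({|[X,Y,Z,X], [YR], [ZR]|} \<in> Phi3 \<and> avoidability_index {|[X,Y,Z,X], [YR], [ZR]|} = 5 \<and>
      (\<forall>\<psi> \<in> Phi3 - {{|[X,Y,Z,X], [YR], [ZR]|}}. avoidability_index \<psi> < 5))"
proof -
  let ?f = "avoidability_index :: var formula \<Rightarrow> enat"
  have i1: "{|[X,X]|} \<in> Phi1" "?f {|[X,X]|} = enat 3" "\<forall>\<psi>\<in>Phi1 - {{|[X,X]|}}. ?f \<psi> < enat 3"
    using avoidability_index_eq[of 2 "{|[X,X]|}"] avoidable_xx not_avoidable_xx
      avoidability_index_less[OF avoidable_xx_rev, of 3]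
    unfolding Phi1_def by (auto simp: numeral_3_eq_3)
  have i2: "{|[X,Y,X], [YR]|} \<in> Phi2" "?f {|[X,Y,X], [YR]|} = enat 4"
    using avoidability_index_eq[of 3 "{|[X,Y,X], [YR]|}"] avoidable_xyx_rev not_avoidable_xyx_rev
    by (simp_all add: Phi2_def)
  have l2: "\<forall>\<psi>\<in>Phi2 - {{|[X,Y,X], [YR]|}}. ?f \<psi> < enat 4"
    using avoidability_index_less[OF avoidable_Phi2, of _ 4] by (intro ballI) simp
  have i3: "{|[X,Y,Z,X], [YR], [ZR]|} \<in> Phi3" "?f {|[X,Y,Z,X], [YR], [ZR]|} = enat 5"
    using avoidability_index_eq[of 4 "{|[X,Y,Z,X], [YR], [ZR]|}"] avoidable_xyzx_rev_rev
      not_avoidable_xyzx_rev_rev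
    by (simp_all add: Phi3_def)
  have l3: "\<forall>\<psi>\<in>Phi3 - {{|[X,Y,Z,X], [YR], [ZR]|}}. ?f \<psi> < enat 5"
    using avoidability_index_less[OF avoidable_Phi3, of _ 5] by (intro ballI) simp
  note u = arg_max_unique[OF i1] arg_max_unique[OF i2 l2] arg_max_unique[OF i3 l3]
  have "\<forall>(n, \<Phi>) \<in> {(1 :: nat, Phi1), (2, Phi2), (3, Phi3)}.
      (\<exists>!\<phi>. is_arg_max ?f (\<lambda>\<psi>. \<psi> \<in> \<Phi>) \<phi>) \<and>
      (\<forall>\<phi>. is_arg_max ?f (\<lambda>\<psi>. \<psi> \<in> \<Phi>) \<phi> \<longrightarrow> ?f \<phi> = enat (n + 2))"
  proof (rule ballI, clarify)
    fix n :: nat and \<Phi> assume "(n, \<Phi>) \<in> {(1, Phi1), (2, Phi2), (3, Phi3)}"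
    then consider "n + 2 = 3" "\<Phi> = Phi1" | "n + 2 = 4" "\<Phi> = Phi2" | "n + 2 = 5" "\<Phi> = Phi3" by auto
    then show "(\<exists>!\<phi>. is_arg_max ?f (\<lambda>\<psi>. \<psi> \<in> \<Phi>) \<phi>) \<and>
        (\<forall>\<phi>. is_arg_max ?f (\<lambda>\<psi>. \<psi> \<in> \<Phi>) \<phi> \<longrightarrow> ?f \<phi> = enat (n + 2))"
    proof cases
      case 1
      show ?thesis unfolding 1 by (rule u(1))
    next
      case 2
      show ?thesis unfolding 2 by (rule u(2))
    next
      case 3
      show ?thesis unfolding 3 by (rule u(3))
    qed
  qed
  then show ?thesis
    unfolding numeral_eq_enat by (intro conjI i1 i2 i3 l2 l3)
qed

end
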